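(* Let $p>3$ be a prime, let $q\ge3$ be an integer and let $\rho\in\mathbb{Q}_p$, with $|\rho|_p\le p^{-2}$ and $|q|_p\le p^{-2}$. Assume that one of the following holds: (i) $p=11$; (ii) $p=19$; (iii) $p\ne11,19$ and $D_0u_{p-2}^2\not\equiv0\pmod p$ and $D_0u_{p-2}^2\not\equiv9a_0^2\pmod p$, where $a_0,b_0\in\{1,\dots,p-1\}$, $a_0\equiv-4/3\pmod p$, $b_0\equiv-38/27\pmod p$, $D_0=-4a_0^3-27b_0^2$, and $u_{n+3}=b_0u_n-a_0u_{n+1}$ ($n\ge1$) with $u_1=0$, $u_2=-a_0$, $u_3=b_0$. In this case, for the $q$-state $p$-adic Potts model on the Cayley tree of order three, there are two translation-invariant generalized $p$-adic quasi Gibbs measures $\mu_0$ and $\tilde\mu$, corresponding respectively to the solution $x_0=1$ and to a root $\tilde x\in\mathbb{Q}_p$ of $x^3-Ax^2-Bx+C=0$. Then the measures $\mu_0$ and $\tilde\mu$ are bounded. In particular, there is a quasi phase transition.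
   Context: $\mathbb{Q}_p$ is the field of $p$-adic numbers with norm $|\cdot|_p$, $|p|_p=1/p$. Tree. $\Gamma^3_+=(V,L)$ is the semi-infinite Cayley tree of order three with root $x^0$: the infinite rooted tree in which every vertex has exactly three direct successors. $W_n$ is the set of vertices at distance $n$ from $x^0$, $V_n=\bigcup_{m=0}^n W_m$, and $L_n$ is the set of edges $\langle x,y\rangle$ with $x,y\in V_n$. Potts model. The state space is $\Phi=\{0,1,\dots,q-1\}$, and $\Omega=\Phi^V$, $\Omega_{V_n}=\Phi^{V_n}$, $\Omega_{W_n}=\Phi^{W_n}$. The Hamiltonian is $H_n(\sigma)=\sum_{\langle x,y\rangle\in L_n}\delta_{\sigma(x),\sigma(y)}$ for $\sigma\in\Omega_{V_n}$ ($\delta$ is the Kronecker symbol). Measures. A $p$-adic (probability) measure is a finitely additive $\mathbb{Q}_p$-valued function $\mu$ on an algebra $\mathcal{B}$ of sets (with total mass $1$); it is bounded if $\sup\{|\mu(A)|_p:A\in\mathcal{B}\}<\infty$ and unbounded otherwise. Given $\rho\in\mathbb{Q}_p$ and a function $\mathbf{h}:V\setminus\{x^0\}\to\mathbb{Q}_p^{\Phi}$, $\mathbf{h}_x=(h_{0,x},\dots,h_{q-1,x})$, normalized (without loss of generality) by $h_{0,x}=1$, define for $n\ge 1$ and $\sigma\in\Omega_{V_n}$ $$\mu^{(n)}_{\mathbf{h},\rho}(\sigma)=\frac{1}{Z^{(\mathbf{h})}_{n,\rho}}\,\rho^{H_n(\sigma)}\prod_{x\in W_n}h_{\sigma(x),x},\qquad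 Z^{(\mathbf{h})}_{n,\rho}=\sum_{\sigma\in\Omega_{V_n}}\rho^{H_n(\sigma)}\prod_{x\in W_n}h_{\sigma(x),x}.$$ If these are compatible, i.e. $\sum_{\omega\in\Omega_{W_n}}\mu^{(n)}_{\mathbf{h},\rho}(\sigma_{n-1}\vee\omega)=\mu^{(n-1)}_{\mathbf{h},\rho}(\sigma_{n-1})$ for all $n\geq 2$ and $\sigma_{n-1}\in\Omega_{V_{n-1}}$ (where $\sigma_{n-1}\vee\omega$ is the concatenated configuration on $V_n$), then there is a unique $p$-adic probability measure $\mu_{\mathbf{h},\rho}$ on the algebra of cylinder subsets of $\Omega$ with $\mu_{\mathbf{h},\rho}(\{\sigma:\sigma|_{V_n}=\sigma_n\})=\mu^{(n)}_{\mathbf{h},\rho}(\sigma_n)$ for all $n\ge1$, $\sigma_n\in\Omega_{V_n}$. Such $\mu_{\mathbf{h},\rho}$ is called a generalized $p$-adic quasi Gibbs measure. It is called translation-invariant if $\mathbf{h}_x$ does not depend on $x\in V\setminus\{x^0\}$. Invariant line. Fix $i_0\in\{1,\dots,q-1\}$. The translation-invariant function with $h_{i_0,x}=h$ and $h_{i,x}=1$ for $i\ne i_0$ (all $x\in V\setminus\{x^0\}$) gives compatible measures iff $h\in\mathbb{Q}_p$ solves the fixed point equation $h=\big(\frac{\rho h+q-1}{h+\rho+q-2}\big)^3$; the resulting measure is said to correspond to the solution $h$. The fixed point equation is equivalent to $(x-1)(x^3-Ax^2-Bx+C)=0$ with $$A=\rho^3-3\rho-3q+5,\quad B=\rho(\rho-3)^2+9q+3\rho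 q(\rho-2)-3q^2-7,\quad C=(q-1)^3.$$ Quasi phase transition. There is a quasi phase transition if there are two different functions $\mathbf{s},\mathbf{h}$ on $V\setminus\{x^0\}$ for which the corresponding generalized $p$-adic quasi Gibbs measures $\mu_{\mathbf{s},\rho}$, $\mu_{\mathbf{h},\rho}$ exist and both are bounded. *)

theory Defs
  imports
    "HOL-Analysis.Analysis"
    "HOL-Number_Theory.Cong"
    "Berlekamp_Zassenhaus.Finite_Field"
begin

section \<open>The field of p-adic numbers\<close>

subsection \<open>The p-adic norm on the rationals\<close>

definition rat_padic_norm :: "nat \<Rightarrow> rat \<Rightarrow> real" where
  "rat_padic_norm p r =
     (if r = 0 then 0
      else real p powi (int (multiplicity (int p) (snd (quotient_of r)))
                      - int (multiplicity (int p) (fst (quotient_of r)))))"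

definition padic_cauchy :: "nat \<Rightarrow> (nat \<Rightarrow> rat) \<Rightarrow> bool" where
  "padic_cauchy p X \<longleftrightarrow>
     (\<forall>e>0. \<exists>k. \<forall>m\<ge>k. \<forall>n\<ge>k. rat_padic_norm p (X m - X n) < e)"

definition padic_null :: "nat \<Rightarrow> (nat \<Rightarrow> rat) \<Rightarrow> bool" where
  "padic_null p X \<longleftrightarrow> (\<forall>e>0. \<exists>k. \<forall>n\<ge>k. rat_padic_norm p (X n) < e)"

definition padic_rel :: "nat \<Rightarrow> (nat \<Rightarrow> rat) \<Rightarrow> (nat \<Rightarrow> rat) \<Rightarrow> bool" where
  "padic_rel p X Y \<longleftrightarrow> padic_cauchy p X \<and> padic_cauchy p Y \<and> padic_null p (\<lambda>n. X n - Y n)"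

lemma rat_padic_norm_0 [simp]: "rat_padic_norm p 0 = 0"
  by (simp add: rat_padic_norm_def)

lemma rat_padic_norm_nonneg [simp]: "rat_padic_norm p r \<ge> 0"
  by (simp add: rat_padic_norm_def)

context
  fixes p :: nat
  assumes p: "prime p"
begin

lemma rat_padic_norm_of_int_div:
  assumes a: "a \<noteq> 0" and b: "b \<noteq> 0"
  shows "rat_padic_norm p (of_int a / of_int b) =
           real p powi (int (multiplicity (int p) b) - int (multiplicity (int p) a))"
proof -
  obtain c d where cd: "quotient_of (of_int a / of_int b) = (c, d)" by fastforce
  have d: "d > 0" using cd by (rule quotient_of_denom_pos)
  have eq: "(of_int a / of_int b :: rat) = of_int c / of_int d"
    using cd by (rule quotient_of_div)
  have "(of_int (a * d) :: rat) = of_int (c * b)"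
    using eq b d by (simp add: field_simps)
  hence adcb: "a * d = c * b" by (simp only: of_int_eq_iff)
  have c: "c \<noteq> 0" using adcb a d by auto
  have pe: "prime_elem (int p)" using p by simp
  have "multiplicity (int p) a + multiplicity (int p) d = multiplicity (int p) c + multiplicity (int p) b"
    using arg_cong[OF adcb, of "multiplicity (int p)"] a b c d
    by (simp add: prime_elem_multiplicity_mult_distrib[OF pe])
  hence "int (multiplicity (int p) d) - int (multiplicity (int p) c) =
         int (multiplicity (int p) b) - int (multiplicity (int p) a)"
    by linarith
  thus ?thesis using a b by (simp add: rat_padic_norm_def cd)
qed

lemma rat_cases_int:
  fixes r :: rat
  assumes "r \<noteq> 0"
  obtains a b where "a \<noteq> 0" "b \<noteq> 0" "r = of_int a / of_int b"
proof -
  obtain a b where q: "quotient_of r = (a, b)" by fastforce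
  have "b > 0" "r = of_int a / of_int b"
    using q by (auto intro: quotient_of_denom_pos quotient_of_div)
  with assms show thesis by (intro that[of a b]) auto
qed

lemma rat_padic_norm_eq_0_iff [simp]: "rat_padic_norm p r = 0 \<longleftrightarrow> r = 0"
  using p prime_gt_0_nat[OF p] by (simp add: rat_padic_norm_def)

lemma rat_padic_norm_mult: "rat_padic_norm p (r * s) = rat_padic_norm p r * rat_padic_norm p s"
proof (cases "r = 0 \<or> s = 0")
  case False
  obtain a b where ab: "a \<noteq> 0" "b \<noteq> 0" "r = of_int a / of_int b"
    using False rat_cases_int by blast
  obtain c d where cd: "c \<noteq> 0" "d \<noteq> 0" "s = of_int c / of_int d"
    using False rat_cases_int by blast
  have pe: "prime_elem (int p)" using p by simp
  have p0: "real p \<noteq> 0" using prime_gt_0_nat[OF p] by simp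
  have "r * s = of_int (a * c) / of_int (b * d)" using ab cd by simp
  hence "rat_padic_norm p (r * s) =
      real p powi (int (multiplicity (int p) (b * d)) - int (multiplicity (int p) (a * c)))"
    using ab cd rat_padic_norm_of_int_div[of "a * c" "b * d"] by simp
  also have "\<dots> = real p powi ((int (multiplicity (int p) b) - int (multiplicity (int p) a)) +
       (int (multiplicity (int p) d) - int (multiplicity (int p) c)))"
    using ab cd by (simp add: prime_elem_multiplicity_mult_distrib[OF pe] algebra_simps)
  also have "\<dots> = rat_padic_norm p r * rat_padic_norm p s"
    using ab cd p0 by (simp only: rat_padic_norm_of_int_div power_int_add simp_thms)
  finally show ?thesis .
qed auto

lemma rat_padic_norm_1 [simp]: "rat_padic_norm p 1 = 1"
  using rat_padic_norm_of_int_div[of 1 1] by simp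

lemma rat_padic_norm_minus [simp]: "rat_padic_norm p (- r) = rat_padic_norm p r"
  using rat_padic_norm_mult[of "- 1" r] rat_padic_norm_of_int_div[of "- 1" 1]
  by (simp add: multiplicity_unit_right)

lemma rat_padic_norm_diff_commute: "rat_padic_norm p (r - s) = rat_padic_norm p (s - r)"
  using rat_padic_norm_minus[of "r - s"] by simp

lemma rat_padic_norm_inverse: "rat_padic_norm p (inverse r) = inverse (rat_padic_norm p r)"
proof (cases "r = 0")
  case False
  have "rat_padic_norm p r * rat_padic_norm p (inverse r) = 1"
    using False by (simp flip: rat_padic_norm_mult)
  thus ?thesis by (metis inverse_unique)
qed auto

lemma rat_padic_norm_add_le_max:
  "rat_padic_norm p (r + s) \<le> max (rat_padic_norm p r) (rat_padic_norm p s)"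
proof (cases "r = 0 \<or> s = 0 \<or> r + s = 0")
  case False
  obtain a b where ab: "a \<noteq> 0" "b \<noteq> 0" "r = of_int a / of_int b"
    using False rat_cases_int by blast
  obtain c d where cd: "c \<noteq> 0" "d \<noteq> 0" "s = of_int c / of_int d"
    using False rat_cases_int by blast
  let ?v = "multiplicity (int p)"
  have p1: "real p > 1" using prime_gt_1_nat[OF p] by simp
  have r: "r = of_int (a * d) / of_int (b * d)" and s: "s = of_int (c * b) / of_int (b * d)"
    using ab cd by auto
  have rs: "r + s = of_int (a * d + c * b) / of_int (b * d)"
    unfolding r s by (simp add: add_divide_distrib)
  have bd: "b * d \<noteq> 0" using ab cd by auto
  have num: "a * d + c * b \<noteq> 0" 
  proof
    assume "a * d + c * b = 0"
    hence "r + s = 0" by (simp only: rs of_int_0 div_0)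
    with False show False by blast
  qed
  have nr: "rat_padic_norm p r = real p powi (int (?v (b * d)) - int (?v (a * d)))"
    unfolding r using ab cd by (intro rat_padic_norm_of_int_div) auto
  have ns: "rat_padic_norm p s = real p powi (int (?v (b * d)) - int (?v (c * b)))"
    unfolding s using ab cd by (intro rat_padic_norm_of_int_div) auto
  have nrs: "rat_padic_norm p (r + s) = real p powi (int (?v (b * d)) - int (?v (a * d + c * b)))"
    unfolding rs using bd num by (intro rat_padic_norm_of_int_div)
  have np: "\<not> is_unit (int p)" using p by auto
  have "int p ^ min (?v (a * d)) (?v (c * b)) dvd a * d + c * b"
    by (intro dvd_add multiplicity_dvd') auto
  hence "min (?v (a * d)) (?v (c * b)) \<le> ?v (a * d + c * b)"
    using num np by (subst (asm) power_dvd_iff_le_multiplicity) auto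
  hence "?v (a * d) \<le> ?v (a * d + c * b) \<or> ?v (c * b) \<le> ?v (a * d + c * b)" by linarith
  thus ?thesis
  proof
    assume "?v (a * d) \<le> ?v (a * d + c * b)"
    hence "rat_padic_norm p (r + s) \<le> rat_padic_norm p r"
      unfolding nrs nr using p1 by (intro power_int_increasing) auto
    thus ?thesis by linarith
  next
    assume "?v (c * b) \<le> ?v (a * d + c * b)"
    hence "rat_padic_norm p (r + s) \<le> rat_padic_norm p s"
      unfolding nrs ns using p1 by (intro power_int_increasing) auto
    thus ?thesis by linarith
  qed
qed (auto simp: le_max_iff_disj)

lemma rat_padic_norm_add_less:
  "rat_padic_norm p r < e \<Longrightarrow> rat_padic_norm p s < e \<Longrightarrow> rat_padic_norm p (r + s) < e"
  using rat_padic_norm_add_le_max[of r s] by linarith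

lemma rat_padic_norm_diff_abs: "\<bar>rat_padic_norm p r - rat_padic_norm p s\<bar> \<le> rat_padic_norm p (r - s)"
proof -
  have "rat_padic_norm p r \<le> max (rat_padic_norm p (r - s)) (rat_padic_norm p s)"
    using rat_padic_norm_add_le_max[of "r - s" s] by simp
  moreover have "rat_padic_norm p s \<le> max (rat_padic_norm p (r - s)) (rat_padic_norm p r)"
    using rat_padic_norm_add_le_max[of "s - r" r] rat_padic_norm_diff_commute[of r s] by simp
  moreover have "rat_padic_norm p (r - s) \<ge> 0" "rat_padic_norm p r \<ge> 0" "rat_padic_norm p s \<ge> 0"
    by simp_all
  ultimately show ?thesis by linarith
qed

lemma padic_cauchy_const [simp]: "padic_cauchy p (\<lambda>n. c)"
  by (simp add: padic_cauchy_def)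

lemma padic_null_const [simp]: "padic_null p (\<lambda>n. c) \<longleftrightarrow> c = 0"
proof
  assume *: "padic_null p (\<lambda>n. c)"
  show "c = 0"
  proof (rule ccontr)
    assume "c \<noteq> 0"
    hence "rat_padic_norm p c > 0"
      using rat_padic_norm_eq_0_iff[of c] rat_padic_norm_nonneg[of p c] by linarith
    with * show False unfolding padic_null_def by blast
  qed
qed (auto simp: padic_null_def)

lemma padic_null_minus: "padic_null p X \<Longrightarrow> padic_null p (\<lambda>n. - X n)"
  by (simp add: padic_null_def)

lemma padic_null_add: 
  assumes "padic_null p X" "padic_null p Y"
  shows "padic_null p (\<lambda>n. X n + Y n)"
  unfolding padic_null_def
proof (intro allI impI)
  fix e :: real assume e: "e > 0"
  obtain i where i: "\<forall>n\<ge>i. rat_padic_norm p (X n) < e" using assms e unfolding padic_null_def by blast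
  obtain j where j: "\<forall>n\<ge>j. rat_padic_norm p (Y n) < e" using assms e unfolding padic_null_def by blast
  show "\<exists>k. \<forall>n\<ge>k. rat_padic_norm p (X n + Y n) < e"
    using i j by (intro exI[of _ "max i j"]) (auto intro: rat_padic_norm_add_less)
qed

lemma padic_cauchy_minus: "padic_cauchy p X \<Longrightarrow> padic_cauchy p (\<lambda>n. - X n)"
  unfolding padic_cauchy_def by (simp only: minus_diff_minus rat_padic_norm_minus)

lemma padic_cauchy_add:
  assumes "padic_cauchy p X" "padic_cauchy p Y"
  shows "padic_cauchy p (\<lambda>n. X n + Y n)"
  unfolding padic_cauchy_def
proof (intro allI impI)
  fix e :: real assume e: "e > 0"
  obtain i where i: "\<forall>m\<ge>i. \<forall>n\<ge>i. rat_padic_norm p (X m - X n) < e"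
    using assms e unfolding padic_cauchy_def by blast
  obtain j where j: "\<forall>m\<ge>j. \<forall>n\<ge>j. rat_padic_norm p (Y m - Y n) < e"
    using assms e unfolding padic_cauchy_def by blast
  show "\<exists>k. \<forall>m\<ge>k. \<forall>n\<ge>k. rat_padic_norm p (X m + Y m - (X n + Y n)) < e"
    unfolding add_diff_add
    using i j by (intro exI[of _ "max i j"]) (auto intro: rat_padic_norm_add_less)
qed

lemma padic_cauchy_bounded:
  assumes "padic_cauchy p X"
  shows "\<exists>b>0. \<forall>n. rat_padic_norm p (X n) < b"
proof -
  obtain k where k: "\<forall>m\<ge>k. \<forall>n\<ge>k. rat_padic_norm p (X m - X n) < 1"
    using assms zero_less_one unfolding padic_cauchy_def by blast
  define b where "b = Max ((\<lambda>n. rat_padic_norm p (X n)) ` {..k}) + 1"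
  have le: "rat_padic_norm p (X n) < b" if "n \<le> k" for n
  proof -
    have "rat_padic_norm p (X n) \<le> Max ((\<lambda>n. rat_padic_norm p (X n)) ` {..k})"
      using that by (intro Max_ge) auto
    thus ?thesis by (simp add: b_def)
  qed
  have b1: "b \<ge> 1"
  proof -
    have "0 \<le> rat_padic_norm p (X k)" by simp
    also have "\<dots> \<le> Max ((\<lambda>n. rat_padic_norm p (X n)) ` {..k})" by (intro Max_ge) auto
    finally show ?thesis by (simp add: b_def)
  qed
  have "rat_padic_norm p (X n) < b" for n
  proof (cases "n \<le> k")
    case False
    hence "rat_padic_norm p (X n - X k) < 1" using k by simp
    hence "rat_padic_norm p (X n - X k) < b" using b1 by linarith
    hence "rat_padic_norm p (X n - X k + X k) < b" using le[of k]
      by (intro rat_padic_norm_add_less) auto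
    thus ?thesis by simp
  qed (use le in auto)
  thus ?thesis using b1 by (intro exI[of _ b]) auto
qed

lemma padic_null_mult_bounded:
  assumes X: "\<exists>b>0. \<forall>n. rat_padic_norm p (X n) < b" and Y: "padic_null p Y"
  shows "padic_null p (\<lambda>n. X n * Y n)"
  unfolding padic_null_def
proof (intro allI impI)
  fix e :: real assume e: "e > 0"
  obtain b where b: "b > 0" "\<forall>n. rat_padic_norm p (X n) < b" using X by blast
  have "e / b > 0" using e b by simp
  then obtain k where k: "\<forall>n\<ge>k. rat_padic_norm p (Y n) < e / b"
    using Y unfolding padic_null_def by blast
  have "rat_padic_norm p (X n * Y n) < e" if "n \<ge> k" for n
  proof -
    have "rat_padic_norm p (X n * Y n) < b * (e / b)"
      unfolding rat_padic_norm_mult using b k that by (intro mult_strict_mono') auto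
    thus ?thesis using b by simp
  qed
  thus "\<exists>k. \<forall>n\<ge>k. rat_padic_norm p (X n * Y n) < e" by blast
qed

lemma padic_cauchy_mult:
  assumes X: "padic_cauchy p X" and Y: "padic_cauchy p Y"
  shows "padic_cauchy p (\<lambda>n. X n * Y n)"
  unfolding padic_cauchy_def
proof (intro allI impI)
  fix e :: real assume e: "e > 0"
  obtain a where a: "a > 0" "\<forall>n. rat_padic_norm p (X n) < a" using padic_cauchy_bounded[OF X] by blast
  obtain b where b: "b > 0" "\<forall>n. rat_padic_norm p (Y n) < b" using padic_cauchy_bounded[OF Y] by blast
  have "e / a > 0" "e / b > 0" using e a b by auto
  then obtain i j where i: "\<forall>m\<ge>i. \<forall>n\<ge>i. rat_padic_norm p (X m - X n) < e / b"
    and j: "\<forall>m\<ge>j. \<forall>n\<ge>j. rat_padic_norm p (Y m - Y n) < e / a"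
    using X Y unfolding padic_cauchy_def by meson
  have "rat_padic_norm p (X m * Y m - X n * Y n) < e" if "m \<ge> max i j" "n \<ge> max i j" for m n
    unfolding mult_diff_mult
  proof (rule rat_padic_norm_add_less)
    have "rat_padic_norm p (X m * (Y m - Y n)) < a * (e / a)"
      unfolding rat_padic_norm_mult using a j that by (intro mult_strict_mono') auto
    thus "rat_padic_norm p (X m * (Y m - Y n)) < e" using a by simp
    have "rat_padic_norm p ((X m - X n) * Y n) < (e / b) * b"
      unfolding rat_padic_norm_mult using b i that by (intro mult_strict_mono') auto
    thus "rat_padic_norm p ((X m - X n) * Y n) < e" using b by simp
  qed
  thus "\<exists>k. \<forall>m\<ge>k. \<forall>n\<ge>k. rat_padic_norm p (X m * Y m - X n * Y n) < e" by blast
qed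

lemma padic_cauchy_not_null:
  assumes X: "padic_cauchy p X" and nz: "\<not> padic_null p X"
  shows "\<exists>b>0. \<exists>k. \<forall>n\<ge>k. b \<le> rat_padic_norm p (X n)"
proof -
  obtain e where e: "e > 0" "\<forall>k. \<exists>n\<ge>k. rat_padic_norm p (X n) \<ge> e"
    using nz unfolding padic_null_def by (auto simp: not_less)
  obtain k where k: "\<forall>m\<ge>k. \<forall>n\<ge>k. rat_padic_norm p (X m - X n) < e"
    using X e unfolding padic_cauchy_def by blast
  obtain m where m: "m \<ge> k" "rat_padic_norm p (X m) \<ge> e" using e by blast
  have "rat_padic_norm p (X n) \<ge> e" if "n \<ge> k" for n
  proof (rule ccontr)
    assume "\<not> ?thesis"
    hence "rat_padic_norm p (X m - X n + X n) < e"
      using k m that by (intro rat_padic_norm_add_less) auto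
    thus False using m by simp
  qed
  thus ?thesis using e by blast
qed

lemma padic_inverse_diff:
  assumes X: "padic_cauchy p X" "\<not> padic_null p X" and Y: "padic_cauchy p Y" "\<not> padic_null p Y"
  obtains k c where "c > 0"
    "\<And>m n. m \<ge> k \<Longrightarrow> n \<ge> k \<Longrightarrow>
       rat_padic_norm p (inverse (X m) - inverse (Y n)) \<le> c * rat_padic_norm p (X m - Y n)"
proof -
  obtain a i where a: "a > 0" "\<forall>n\<ge>i. a \<le> rat_padic_norm p (X n)"
    using padic_cauchy_not_null[OF X] by blast
  obtain b j where b: "b > 0" "\<forall>n\<ge>j. b \<le> rat_padic_norm p (Y n)"
    using padic_cauchy_not_null[OF Y] by blast
  have "rat_padic_norm p (inverse (X m) - inverse (Y n)) \<le>
      (inverse a * inverse b) * rat_padic_norm p (X m - Y n)"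
    if "m \<ge> max i j" "n \<ge> max i j" for m n
  proof -
    have nz: "X m \<noteq> 0" "Y n \<noteq> 0" using a b that by (force)+
    have "rat_padic_norm p (inverse (X m) - inverse (Y n)) =
       (inverse (rat_padic_norm p (X m)) * inverse (rat_padic_norm p (Y n))) * rat_padic_norm p (X m - Y n)"
      by (simp add: inverse_diff_inverse[OF nz] rat_padic_norm_mult rat_padic_norm_inverse)
    also have "\<dots> \<le> (inverse a * inverse b) * rat_padic_norm p (X m - Y n)"
      using a b that by (intro mult_right_mono mult_mono le_imp_inverse_le) auto
    finally show ?thesis .
  qed
  thus thesis using a b by (intro that[of "inverse a * inverse b" "max i j"]) auto
qed

lemma padic_cauchy_inverse:
  assumes X: "padic_cauchy p X" "\<not> padic_null p X"
  shows "padic_cauchy p (\<lambda>n. inverse (X n))"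
  unfolding padic_cauchy_def
proof (intro allI impI)
  fix e :: real assume e: "e > 0"
  obtain k c where c: "c > 0" and kc: "\<And>m n. m \<ge> k \<Longrightarrow> n \<ge> k \<Longrightarrow>
       rat_padic_norm p (inverse (X m) - inverse (X n)) \<le> c * rat_padic_norm p (X m - X n)"
    by (rule padic_inverse_diff[OF X X]) (rule that)
  have "e / c > 0" using e c by simp
  then obtain l where l: "\<forall>m\<ge>l. \<forall>n\<ge>l. rat_padic_norm p (X m - X n) < e / c"
    using X unfolding padic_cauchy_def by blast
  have "rat_padic_norm p (inverse (X m) - inverse (X n)) < e" if "m \<ge> max k l" "n \<ge> max k l" for m n
  proof -
    have "rat_padic_norm p (inverse (X m) - inverse (X n)) \<le> c * rat_padic_norm p (X m - X n)"
      using kc that by simp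
    also have "\<dots> < c * (e / c)" using l c that by (intro mult_strict_left_mono) auto
    finally show ?thesis using c by simp
  qed
  thus "\<exists>k. \<forall>m\<ge>k. \<forall>n\<ge>k. rat_padic_norm p (inverse (X m) - inverse (X n)) < e" by blast
qed

lemma padic_null_diff_inverse:
  assumes X: "padic_cauchy p X" "\<not> padic_null p X" and Y: "padic_cauchy p Y" "\<not> padic_null p Y"
    and XY: "padic_null p (\<lambda>n. X n - Y n)"
  shows "padic_null p (\<lambda>n. inverse (X n) - inverse (Y n))"
  unfolding padic_null_def
proof (intro allI impI)
  fix e :: real assume e: "e > 0"
  obtain k c where c: "c > 0" and kc: "\<And>m n. m \<ge> k \<Longrightarrow> n \<ge> k \<Longrightarrow>
       rat_padic_norm p (inverse (X m) - inverse (Y n)) \<le> c * rat_padic_norm p (X m - Y n)"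
    by (rule padic_inverse_diff[OF X Y]) (rule that)
  have "e / c > 0" using e c by simp
  then obtain l where l: "\<forall>n\<ge>l. rat_padic_norm p (X n - Y n) < e / c"
    using XY unfolding padic_null_def by blast
  have "rat_padic_norm p (inverse (X n) - inverse (Y n)) < e" if "n \<ge> max k l" for n
  proof -
    have "rat_padic_norm p (inverse (X n) - inverse (Y n)) \<le> c * rat_padic_norm p (X n - Y n)"
      using kc that by simp
    also have "\<dots> < c * (e / c)" using l c that by (intro mult_strict_left_mono) auto
    finally show ?thesis using c by simp
  qed
  thus "\<exists>k. \<forall>n\<ge>k. rat_padic_norm p (inverse (X n) - inverse (Y n)) < e" by blast
qed

lemma padic_rel_sym: "padic_rel p X Y \<Longrightarrow> padic_rel p Y X"
  using padic_null_minus[of "\<lambda>n. X n - Y n"] by (simp add: padic_rel_def)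

lemma padic_rel_trans:
  assumes "padic_rel p X Y" "padic_rel p Y Z"
  shows "padic_rel p X Z"
  using padic_null_add[of "\<lambda>n. X n - Y n" "\<lambda>n. Y n - Z n"] assms by (simp add: padic_rel_def)

lemma tendsto_rat_padic_norm_diff:
  assumes "padic_rel p X Y"
  shows "(\<lambda>n. rat_padic_norm p (X n) - rat_padic_norm p (Y n)) \<longlonglongrightarrow> 0"
proof (rule LIMSEQ_I)
  fix e :: real assume "e > 0"
  then obtain k where k: "\<forall>n\<ge>k. rat_padic_norm p (X n - Y n) < e"
    using assms unfolding padic_rel_def padic_null_def by blast
  show "\<exists>k. \<forall>n\<ge>k. norm (rat_padic_norm p (X n) - rat_padic_norm p (Y n) - 0) < e"
  proof (intro exI[of _ k] allI impI)
    fix n assume "n \<ge> k"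
    with k have "rat_padic_norm p (X n - Y n) < e" by blast
    thus "norm (rat_padic_norm p (X n) - rat_padic_norm p (Y n) - 0) < e"
      using rat_padic_norm_diff_abs[of "X n" "Y n"] by simp
  qed
qed

lemma convergent_rat_padic_norm:
  assumes "padic_cauchy p X"
  shows "convergent (\<lambda>n. rat_padic_norm p (X n))"
proof -
  have "Cauchy (\<lambda>n. rat_padic_norm p (X n))"
  proof (rule CauchyI)
    fix e :: real assume "e > 0"
    then obtain k where k: "\<forall>m\<ge>k. \<forall>n\<ge>k. rat_padic_norm p (X m - X n) < e"
      using assms unfolding padic_cauchy_def by blast
    show "\<exists>k. \<forall>m\<ge>k. \<forall>n\<ge>k. norm (rat_padic_norm p (X m) - rat_padic_norm p (X n)) < e"
    proof (intro exI[of _ k] allI impI)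
      fix m n assume "m \<ge> k" "n \<ge> k"
      with k have "rat_padic_norm p (X m - X n) < e" by blast
      thus "norm (rat_padic_norm p (X m) - rat_padic_norm p (X n)) < e"
        using rat_padic_norm_diff_abs[of "X m" "X n"] by simp
    qed
  qed
  thus ?thesis by (simp add: Cauchy_convergent_iff)
qed

lemma lim_rat_padic_norm_cong:
  assumes "padic_rel p X Y"
  shows "lim (\<lambda>n. rat_padic_norm p (X n)) = lim (\<lambda>n. rat_padic_norm p (Y n))"
proof -
  have "(\<lambda>n. rat_padic_norm p (Y n)) \<longlonglongrightarrow> lim (\<lambda>n. rat_padic_norm p (Y n))"
    using assms convergent_rat_padic_norm by (simp add: padic_rel_def convergent_LIMSEQ_iff)
  from tendsto_add[OF tendsto_rat_padic_norm_diff[OF assms] this]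
  show ?thesis by (simp add: limI)
qed

end

subsection \<open>Completion\<close>

text \<open>
  The type \<open>'p padic\<close> is the field of p-adic numbers for the prime \<open>p = CARD('p)\<close>: the
  completion of the rationals, i.e. p-adic Cauchy sequences modulo p-adic null sequences.
\<close>

typedef (overloaded) 'p padic =
  "{X. padic_cauchy CARD('p::prime_card) X} // {(X, Y). padic_rel CARD('p) X Y}"
proof -
  have "padic_cauchy CARD('p) (\<lambda>_. 0)" by (simp add: prime_card)
  thus ?thesis by (blast intro: quotientI)
qed

definition padic_of_seq :: "(nat \<Rightarrow> rat) \<Rightarrow> 'p::prime_card padic" where
  "padic_of_seq X = Abs_padic ({(X, Y). padic_rel CARD('p) X Y} `` {X})"

definition seq_of_padic :: "'p::prime_card padic \<Rightarrow> nat \<Rightarrow> rat" where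
  "seq_of_padic x = (SOME X. X \<in> Rep_padic x)"

lemma equiv_padic_rel:
  "equiv {X. padic_cauchy CARD('p::prime_card) X} {(X, Y). padic_rel CARD('p) X Y}"
proof (rule equivI)
  show "{(X, Y). padic_rel CARD('p) X Y} \<subseteq> {X. padic_cauchy CARD('p) X} \<times> {X. padic_cauchy CARD('p) X}"
    by (auto simp: padic_rel_def)
  show "refl_on {X. padic_cauchy CARD('p) X} {(X, Y). padic_rel CARD('p) X Y}"
    by (auto simp: refl_on_def padic_rel_def prime_card)
  show "sym {(X, Y). padic_rel CARD('p) X Y}"
    using padic_rel_sym[OF prime_card] by (auto simp: sym_def)
  show "trans {(X, Y). padic_rel CARD('p) X Y}"
    using padic_rel_trans[OF prime_card] by (auto simp: trans_def)
qed

lemma padic_of_seq_eq_iff: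
  assumes "padic_cauchy CARD('p) X" "padic_cauchy CARD('p) Y"
  shows "(padic_of_seq X :: 'p::prime_card padic) = padic_of_seq Y \<longleftrightarrow>
           padic_null CARD('p) (\<lambda>n. X n - Y n)"
proof -
  let ?R = "{(X, Y). padic_rel CARD('p) X Y}"
  have "(padic_of_seq X :: 'p padic) = padic_of_seq Y \<longleftrightarrow> ?R `` {X} = ?R `` {Y}"
    unfolding padic_of_seq_def using assms by (intro Abs_padic_inject quotientI) auto
  also have "\<dots> \<longleftrightarrow> padic_rel CARD('p) X Y"
    using eq_equiv_class_iff[OF equiv_padic_rel, of X Y] assms by auto
  finally show ?thesis using assms by (simp add: padic_rel_def)
qed

lemma padic_of_seq_of_padic:
  fixes x :: "'p::prime_card padic"
  shows "padic_cauchy CARD('p) (seq_of_padic x)" "padic_of_seq (seq_of_padic x) = x"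
proof -
  let ?R = "{(X, Y). padic_rel CARD('p) X Y}"
  obtain X where X: "padic_cauchy CARD('p) X" "Rep_padic x = ?R `` {X}"
    using Rep_padic[of x] by (auto elim!: quotientE)
  have "X \<in> Rep_padic x" using X by (auto simp: padic_rel_def prime_card)
  hence *: "seq_of_padic x \<in> Rep_padic x" unfolding seq_of_padic_def by (rule someI[of "\<lambda>X. X \<in> Rep_padic x"])
  thus c: "padic_cauchy CARD('p) (seq_of_padic x)" using X by (auto simp: padic_rel_def)
  have "Rep_padic x = ?R `` {seq_of_padic x}"
    using * X equiv_class_eq[OF equiv_padic_rel, of X "seq_of_padic x"] by auto
  thus "padic_of_seq (seq_of_padic x) = x"
    unfolding padic_of_seq_def by (metis Rep_padic_inverse)
qed

lemma padic_induct [case_names of_seq, induct type: padic]: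
  fixes x :: "'p::prime_card padic"
  assumes "\<And>X. padic_cauchy CARD('p) X \<Longrightarrow> P (padic_of_seq X)"
  shows "P x"
  using assms[OF padic_of_seq_of_padic(1)[of x]] by (simp add: padic_of_seq_of_padic)

lemma seq_of_padic_of_seq:
  assumes "padic_cauchy CARD('p) X"
  shows "padic_rel CARD('p) (seq_of_padic (padic_of_seq X :: 'p::prime_card padic)) X"
  using padic_of_seq_eq_iff[OF padic_of_seq_of_padic(1) assms, of "padic_of_seq X :: 'p padic"]
  by (simp add: padic_rel_def assms padic_of_seq_of_padic)

instantiation padic :: (prime_card) field
begin

definition zero_padic :: "'a padic" where
  "0 = padic_of_seq (\<lambda>_. 0)"

definition one_padic :: "'a padic" where
  "1 = padic_of_seq (\<lambda>_. 1)"

definition plus_padic :: "'a padic \<Rightarrow> 'a padic \<Rightarrow> 'a padic" where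
  "x + y = padic_of_seq (\<lambda>n. seq_of_padic x n + seq_of_padic y n)"

definition uminus_padic :: "'a padic \<Rightarrow> 'a padic" where
  "- x = padic_of_seq (\<lambda>n. - seq_of_padic x n)"

definition minus_padic :: "'a padic \<Rightarrow> 'a padic \<Rightarrow> 'a padic" where
  "(x :: 'a padic) - y = x + - y"

definition times_padic :: "'a padic \<Rightarrow> 'a padic \<Rightarrow> 'a padic" where
  "x * y = padic_of_seq (\<lambda>n. seq_of_padic x n * seq_of_padic y n)"

definition inverse_padic :: "'a padic \<Rightarrow> 'a padic" where
  "inverse x = (if x = 0 then 0 else padic_of_seq (\<lambda>n. inverse (seq_of_padic x n)))"

definition divide_padic :: "'a padic \<Rightarrow> 'a padic \<Rightarrow> 'a padic" where
  "(x :: 'a padic) div y = x * inverse y"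

lemma plus_padic_of_seq:
  assumes X: "padic_cauchy CARD('a) X" and Y: "padic_cauchy CARD('a) Y"
  shows "(padic_of_seq X + padic_of_seq Y :: 'a padic) = padic_of_seq (\<lambda>n. X n + Y n)"
proof -
  note p = prime_card[where 'a = 'a]
  show ?thesis
    using seq_of_padic_of_seq[OF X] seq_of_padic_of_seq[OF Y]
    unfolding plus_padic_def
    by (subst padic_of_seq_eq_iff)
      (simp_all add: padic_rel_def padic_cauchy_add[OF p] padic_null_add[OF p] add_diff_add)
qed

lemma uminus_padic_of_seq:
  assumes X: "padic_cauchy CARD('a) X"
  shows "(- padic_of_seq X :: 'a padic) = padic_of_seq (\<lambda>n. - X n)"
proof -
  note p = prime_card[where 'a = 'a]
  from seq_of_padic_of_seq[OF X] have
    "padic_null CARD('a) (\<lambda>n. - (seq_of_padic (padic_of_seq X :: 'a padic) n - X n))"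
    by (intro padic_null_minus[OF p]) (simp add: padic_rel_def)
  thus ?thesis
    using seq_of_padic_of_seq[OF X]
    unfolding uminus_padic_def
    by (subst padic_of_seq_eq_iff)
      (simp_all add: padic_rel_def padic_cauchy_minus[OF p])
qed

lemma times_padic_of_seq:
  assumes X: "padic_cauchy CARD('a) X" and Y: "padic_cauchy CARD('a) Y"
  shows "(padic_of_seq X * padic_of_seq Y :: 'a padic) = padic_of_seq (\<lambda>n. X n * Y n)"
proof -
  note p = prime_card[where 'a = 'a]
  define X' where "X' = seq_of_padic (padic_of_seq X :: 'a padic)"
  define Y' where "Y' = seq_of_padic (padic_of_seq Y :: 'a padic)"
  have X': "padic_rel CARD('a) X' X" unfolding X'_def by (rule seq_of_padic_of_seq[OF X])
  have Y': "padic_rel CARD('a) Y' Y" unfolding Y'_def by (rule seq_of_padic_of_seq[OF Y])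
  have "padic_null CARD('a) (\<lambda>n. X' n * (Y' n - Y n))"
    using X' Y' by (intro padic_null_mult_bounded[OF p] padic_cauchy_bounded[OF p]) (auto simp: padic_rel_def)
  moreover have "padic_null CARD('a) (\<lambda>n. Y n * (X' n - X n))"
    using X' Y' by (intro padic_null_mult_bounded[OF p] padic_cauchy_bounded[OF p]) (auto simp: padic_rel_def)
  ultimately have "padic_null CARD('a) (\<lambda>n. X' n * (Y' n - Y n) + Y n * (X' n - X n))"
    by (rule padic_null_add[OF p])
  hence "padic_null CARD('a) (\<lambda>n. X' n * Y' n - X n * Y n)"
    by (simp add: algebra_simps)
  thus ?thesis
    using X' Y' unfolding times_padic_def X'_def[symmetric] Y'_def[symmetric]
    by (subst padic_of_seq_eq_iff) (simp_all add: padic_rel_def padic_cauchy_mult[OF p])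
qed

instance
proof
  note p = prime_card[where 'a = 'a]
  note seq = zero_padic_def one_padic_def plus_padic_of_seq uminus_padic_of_seq times_padic_of_seq
    padic_cauchy_add[OF p] padic_cauchy_minus[OF p] padic_cauchy_mult[OF p] padic_cauchy_const[OF p]
  fix a b c :: "'a padic"
  show "a * b * c = a * (b * c)"
    by (induction a; induction b; induction c) (simp add: seq mult.assoc)
  show "a * b = b * a"
    by (induction a; induction b) (simp add: seq mult.commute)
  show "1 * a = a"
    by (induction a) (simp add: seq)
  show "a + b + c = a + (b + c)"
    by (induction a; induction b; induction c) (simp add: seq add.assoc)
  show "a + b = b + a"
    by (induction a; induction b) (simp add: seq add.commute)
  show "0 + a = a"
    by (induction a) (simp add: seq)
  show "- a + a = 0"
    by (induction a) (simp add: seq)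
  show "a - b = a + - b"
    by (fact minus_padic_def)
  show "(a + b) * c = a * c + b * c"
    by (induction a; induction b; induction c) (simp add: seq distrib_right)
  show "(0::'a padic) \<noteq> 1"
    by (simp add: zero_padic_def one_padic_def padic_of_seq_eq_iff p)
  show "a div b = a * inverse b"
    by (fact divide_padic_def)
  show "inverse (0::'a padic) = 0"
    by (simp add: inverse_padic_def)
  assume a0: "a \<noteq> 0"
  define X where "X = seq_of_padic a"
  have X: "padic_cauchy CARD('a) X" "a = padic_of_seq X"
    using padic_of_seq_of_padic[of a] by (simp_all add: X_def)
  have nX: "\<not> padic_null CARD('a) X"
    using a0 X(1) unfolding X(2) by (simp add: zero_padic_def padic_of_seq_eq_iff p)
  obtain b k where b: "b > 0" "\<forall>n\<ge>k. b \<le> rat_padic_norm CARD('a) (X n)"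
    using padic_cauchy_not_null[OF p X(1) nX] by blast
  have "padic_null CARD('a) (\<lambda>n. inverse (X n) * X n - 1)"
    unfolding padic_null_def
  proof (intro allI impI exI[of _ k])
    fix e :: real and n assume "e > 0" "n \<ge> k"
    moreover from this b have "X n \<noteq> 0" by force
    ultimately show "rat_padic_norm CARD('a) (inverse (X n) * X n - 1) < e" by simp
  qed
  hence "padic_of_seq (\<lambda>n. inverse (X n)) * padic_of_seq X = (1 :: 'a padic)"
    using X(1) nX by (simp add: seq padic_cauchy_inverse[OF p] padic_of_seq_eq_iff)
  thus "inverse a * a = 1"
    using a0 by (simp add: inverse_padic_def X(2)[symmetric] X_def[symmetric])
qed

end

definition padic_norm :: "'p::prime_card padic \<Rightarrow> real" where
  "padic_norm x = lim (\<lambda>n. rat_padic_norm CARD('p) (seq_of_padic x n))"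

lemma padic_norm_of_seq:
  assumes "padic_cauchy CARD('p) X"
  shows "padic_norm (padic_of_seq X :: 'p::prime_card padic) = lim (\<lambda>n. rat_padic_norm CARD('p) (X n))"
  unfolding padic_norm_def
  by (rule lim_rat_padic_norm_cong[OF prime_card seq_of_padic_of_seq[OF assms]])

lemma of_nat_padic: "(of_nat n :: 'p::prime_card padic) = padic_of_seq (\<lambda>_. of_nat n)"
  by (induction n)
    (simp_all add: zero_padic_def one_padic_def plus_padic_of_seq prime_card)

lemma padic_norm_of_nat: "padic_norm (of_nat n :: 'p::prime_card padic) = rat_padic_norm CARD('p) (of_nat n)"
  by (simp add: of_nat_padic padic_norm_of_seq prime_card)

lemma padic_norm_prime: "padic_norm (of_nat CARD('p) :: 'p::prime_card padic) = 1 / real CARD('p)"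
proof -
  have "CARD('p) \<noteq> 0" using prime_card[where 'a = 'p] by (metis not_prime_0)
  moreover have "\<not> is_unit (int CARD('p))" using prime_card_int[where 'a = 'p] not_prime_unit by blast
  ultimately show ?thesis
    using rat_padic_norm_of_int_div[OF prime_card[where 'a='p], of "int CARD('p)" 1]
    by (simp add: padic_norm_of_nat multiplicity_self power_int_minus field_simps)
qed

section \<open>The Potts model on the Cayley tree of order three\<close>

subsection \<open>The tree\<close>

text \<open>
  A vertex is the word of choices (most recent first) on the path from the root, so the direct
  successors of \<open>x\<close> are the three words \<open>i # x\<close>, and the distance to the root is the length.
\<close>

type_synonym vertex = "3 list"

abbreviation root :: vertex where
  "root \<equiv> []"

definition tree_W :: "nat \<Rightarrow> vertex set" where
  "tree_W n = {x. length x = n}"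

definition tree_V :: "nat \<Rightarrow> vertex set" where
  "tree_V n = (\<Union>m\<le>n. tree_W m)"

text \<open>Each edge is listed once, as the pair of a vertex and its direct successor.\<close>

definition tree_L :: "nat \<Rightarrow> (vertex \<times> vertex) set" where
  "tree_L n = {(x, y). x \<in> tree_V n \<and> y \<in> tree_V n \<and> (\<exists>i. y = i # x)}"

subsection \<open>Configurations and finite-volume measures\<close>

definition configs :: "nat \<Rightarrow> (vertex \<Rightarrow> nat) set" where
  "configs q = (UNIV \<rightarrow> {..<q})"

definition configs_on :: "nat \<Rightarrow> vertex set \<Rightarrow> (vertex \<Rightarrow> nat) set" where
  "configs_on q U = (U \<rightarrow>\<^sub>E {..<q})"

definition hamiltonian :: "nat \<Rightarrow> (vertex \<Rightarrow> nat) \<Rightarrow> nat" where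
  "hamiltonian n \<sigma> = (\<Sum>(x, y)\<in>tree_L n. of_bool (\<sigma> x = \<sigma> y))"

text \<open>
  A boundary function is written \<open>h x i\<close> for \<open>h\<^bsub>i,x\<^esub>\<close>. Only its values at \<open>x \<noteq> root\<close> and
  \<open>i < q\<close> are meaningful.
\<close>

definition potts_weight ::
  "'p::prime_card padic \<Rightarrow> (vertex \<Rightarrow> nat \<Rightarrow> 'p padic) \<Rightarrow> nat \<Rightarrow> (vertex \<Rightarrow> nat) \<Rightarrow> 'p padic" where
  "potts_weight \<rho> h n \<sigma> = \<rho> ^ hamiltonian n \<sigma> * (\<Prod>x\<in>tree_W n. h x (\<sigma> x))"

definition potts_Z ::
  "nat \<Rightarrow> 'p::prime_card padic \<Rightarrow> (vertex \<Rightarrow> nat \<Rightarrow> 'p padic) \<Rightarrow> nat \<Rightarrow> 'p padic" where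
  "potts_Z q \<rho> h n = (\<Sum>\<sigma>\<in>configs_on q (tree_V n). potts_weight \<rho> h n \<sigma>)"

definition potts_mu ::
  "nat \<Rightarrow> 'p::prime_card padic \<Rightarrow> (vertex \<Rightarrow> nat \<Rightarrow> 'p padic) \<Rightarrow> nat \<Rightarrow> (vertex \<Rightarrow> nat) \<Rightarrow> 'p padic" where
  "potts_mu q \<rho> h n \<sigma> = 1 / potts_Z q \<rho> h n * potts_weight \<rho> h n \<sigma>"

definition concat_config :: "nat \<Rightarrow> (vertex \<Rightarrow> nat) \<Rightarrow> (vertex \<Rightarrow> nat) \<Rightarrow> vertex \<Rightarrow> nat" where
  "concat_config n \<sigma> \<omega> = (\<lambda>x. if x \<in> tree_W n then \<omega> x else \<sigma> x)"

text \<open>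
  The finite-volume measures are defined only if the normalizing factors do not vanish; since
  division by zero is total in HOL this is part of compatibility.
\<close>

definition compatible ::
  "nat \<Rightarrow> 'p::prime_card padic \<Rightarrow> (vertex \<Rightarrow> nat \<Rightarrow> 'p padic) \<Rightarrow> bool" where
  "compatible q \<rho> h \<longleftrightarrow>
     (\<forall>n\<ge>1. potts_Z q \<rho> h n \<noteq> 0) \<and>
     (\<forall>n\<ge>2. \<forall>\<sigma>\<in>configs_on q (tree_V (n - 1)).
        (\<Sum>\<omega>\<in>configs_on q (tree_W n). potts_mu q \<rho> h n (concat_config n \<sigma> \<omega>)) =
        potts_mu q \<rho> h (n - 1) \<sigma>)"

subsection \<open>p-adic measures\<close>

definition padic_measure :: "'a set \<Rightarrow> 'a set set \<Rightarrow> ('a set \<Rightarrow> 'p::prime_card padic) \<Rightarrow> bool" where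
  "padic_measure \<Omega> \<B> \<mu> \<longleftrightarrow>
     Sigma_Algebra.algebra \<Omega> \<B> \<and> (\<forall>A\<in>\<B>. \<forall>B\<in>\<B>. A \<inter> B = {} \<longrightarrow> \<mu> (A \<union> B) = \<mu> A + \<mu> B)"

definition padic_prob_measure :: "'a set \<Rightarrow> 'a set set \<Rightarrow> ('a set \<Rightarrow> 'p::prime_card padic) \<Rightarrow> bool" where
  "padic_prob_measure \<Omega> \<B> \<mu> \<longleftrightarrow> padic_measure \<Omega> \<B> \<mu> \<and> \<mu> \<Omega> = 1"

definition padic_bounded :: "'a set set \<Rightarrow> ('a set \<Rightarrow> 'p::prime_card padic) \<Rightarrow> bool" where
  "padic_bounded \<B> \<mu> \<longleftrightarrow> bdd_above ((\<lambda>A. padic_norm (\<mu> A)) ` \<B>)"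

definition cylinder :: "nat \<Rightarrow> nat \<Rightarrow> (vertex \<Rightarrow> nat) set \<Rightarrow> (vertex \<Rightarrow> nat) set" where
  "cylinder q n E = {\<sigma> \<in> configs q. restrict \<sigma> (tree_V n) \<in> E}"

definition cylinders :: "nat \<Rightarrow> (vertex \<Rightarrow> nat) set set" where
  "cylinders q = {cylinder q n E | n E. E \<subseteq> configs_on q (tree_V n)}"

subsection \<open>Generalized p-adic quasi Gibbs measures\<close>

definition quasi_gibbs_measure ::
  "nat \<Rightarrow> 'p::prime_card padic \<Rightarrow> (vertex \<Rightarrow> nat \<Rightarrow> 'p padic) \<Rightarrow>
     ((vertex \<Rightarrow> nat) set \<Rightarrow> 'p padic) \<Rightarrow> bool" where
  "quasi_gibbs_measure q \<rho> h \<mu> \<longleftrightarrow>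
     (\<forall>x. x \<noteq> root \<longrightarrow> h x 0 = 1) \<and>
     compatible q \<rho> h \<and>
     padic_prob_measure (configs q) (cylinders q) \<mu> \<and>
     (\<forall>n\<ge>1. \<forall>\<sigma>\<in>configs_on q (tree_V n). \<mu> (cylinder q n {\<sigma>}) = potts_mu q \<rho> h n \<sigma>)"

definition translation_invariant :: "nat \<Rightarrow> (vertex \<Rightarrow> nat \<Rightarrow> 'p padic) \<Rightarrow> bool" where
  "translation_invariant q h \<longleftrightarrow>
     (\<forall>x y. x \<noteq> root \<longrightarrow> y \<noteq> root \<longrightarrow> (\<forall>i<q. h x i = h y i))"

definition translation_invariant_quasi_gibbs ::
  "nat \<Rightarrow> 'p::prime_card padic \<Rightarrow> ((vertex \<Rightarrow> nat) set \<Rightarrow> 'p padic) \<Rightarrow> bool" where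
  "translation_invariant_quasi_gibbs q \<rho> \<mu> \<longleftrightarrow>
     (\<exists>h. translation_invariant q h \<and> quasi_gibbs_measure q \<rho> h \<mu>)"

definition invariant_line :: "nat \<Rightarrow> 'p::prime_card padic \<Rightarrow> vertex \<Rightarrow> nat \<Rightarrow> 'p padic" where
  "invariant_line i\<^sub>0 h = (\<lambda>x i. if i = i\<^sub>0 then h else 1)"

definition fixed_point_equation :: "nat \<Rightarrow> 'p::prime_card padic \<Rightarrow> 'p padic \<Rightarrow> bool" where
  "fixed_point_equation q \<rho> h \<longleftrightarrow>
     h + \<rho> + of_nat q - 2 \<noteq> 0 \<and>
     h = ((\<rho> * h + of_nat q - 1) / (h + \<rho> + of_nat q - 2)) ^ 3"

definition corresponds_to ::
  "nat \<Rightarrow> 'p::prime_card padic \<Rightarrow> nat \<Rightarrow> ((vertex \<Rightarrow> nat) set \<Rightarrow> 'p padic) \<Rightarrow> 'p padic \<Rightarrow> bool" where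
  "corresponds_to q \<rho> i\<^sub>0 \<mu> h \<longleftrightarrow>
     fixed_point_equation q \<rho> h \<and> quasi_gibbs_measure q \<rho> (invariant_line i\<^sub>0 h) \<mu>"

definition cubic :: "nat \<Rightarrow> 'p::prime_card padic \<Rightarrow> 'p padic \<Rightarrow> 'p padic" where
  "cubic q \<rho> x =
     (let A = \<rho> ^ 3 - 3 * \<rho> - 3 * of_nat q + 5;
          B = \<rho> * (\<rho> - 3) ^ 2 + 9 * of_nat q + 3 * \<rho> * of_nat q * (\<rho> - 2) - 3 * of_nat q ^ 2 - 7;
          C = (of_nat q - 1) ^ 3
      in x ^ 3 - A * x ^ 2 - B * x + C)"

text \<open>
  The two boundary functions are compared on the non-root vertices and on the state space only.
\<close>

definition quasi_phase_transition :: "nat \<Rightarrow> 'p::prime_card padic \<Rightarrow> bool" where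
  "quasi_phase_transition q \<rho> \<longleftrightarrow>
     (\<exists>s h \<mu>\<^sub>s \<mu>\<^sub>h.
        (\<exists>x i. x \<noteq> root \<and> i < q \<and> s x i \<noteq> h x i) \<and>
        quasi_gibbs_measure q \<rho> s \<mu>\<^sub>s \<and> quasi_gibbs_measure q \<rho> h \<mu>\<^sub>h \<and>
        padic_bounded (cylinders q) \<mu>\<^sub>s \<and> padic_bounded (cylinders q) \<mu>\<^sub>h)"

end

theory Submission
  imports Defs "Berlekamp_Zassenhaus.Berlekamp_Type_Based"
begin

text \<open>
  Modulo \<open>p\<close> the cubic is \<open>F(x) = x\<^sup>3 - 5 x\<^sup>2 + 7 x - 1\<close>, and \<open>x = y + 5/3\<close> turns it into
  \<open>y\<^sup>3 + a\<^sub>0 y - b\<^sub>0\<close>. If the latter had no root in the prime field, it would be irreducible and \<open>X\<^sup>p\<close> would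
  be a conjugate of \<open>X\<close> modulo it; the coefficient of \<open>X\<^sup>2\<close> in that conjugate is \<open>u\<^bsub>p-2\<^esub>\<close> and satisfies
  \<open>D\<^sub>0 u\<^bsub>p-2\<^esub>\<^sup>2 = 9 a\<^sub>0\<^sup>2\<close>. So \<open>F\<close> has a root modulo \<open>p\<close>, which is \<open>y = 0\<close> for \<open>p = 19\<close>. It is simple unless
  \<open>p\<close> divides the discriminant \<open>- 44\<close>, and \<open>4\<close> is a simple root for \<open>p = 11\<close>. A simple root lifts
  to the p-adic numbers by a contraction argument.

  Summing out the last generation shows \<open>Z\<^bsub>n+1\<^esub> = c\<^sup>m Z\<^sub>n\<close> with \<open>m = 3 \<bar>W\<^sub>n\<bar>\<close>, \<open>c = h + \<rho> + q - 2\<close> and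
  \<open>Z\<^sub>0 = h + q - 1\<close>. Since \<open>F(2) = 1\<close> and \<open>F(1) = 2\<close>, a root \<open>h\<close> of the cubic is congruent neither to \<open>2\<close> nor to \<open>1\<close>,
  so \<open>c\<close> and all \<open>Z\<^sub>n\<close> are units. For \<open>h = 1\<close> again \<open>c\<close> is a unit, and \<open>\<bar>Z\<^sub>n\<bar> = \<bar>q\<bar>\<close> for all \<open>n\<close>. Hence the
  densities are bounded by \<open>1\<close> and by \<open>1 / \<bar>q\<bar>\<close>, respectively, and by the ultrametric inequality so are
  the measures.
\<close>

section \<open>The p-adic norm and completeness\<close>

lemma padic_norm_LIMSEQ:
  assumes "padic_cauchy CARD('p) X"
  shows "(\<lambda>n. rat_padic_norm CARD('p) (X n)) \<longlonglongrightarrow> padic_norm (padic_of_seq X :: 'p::prime_card padic)"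
  using convergent_rat_padic_norm[OF prime_card assms] padic_norm_of_seq[OF assms]
  by (simp add: convergent_LIMSEQ_iff)

lemma padic_norm_nonneg [simp]: "padic_norm (x :: 'p::prime_card padic) \<ge> 0"
proof (induction x)
  case (of_seq X)
  show ?case
    by (rule LIMSEQ_le_const[OF padic_norm_LIMSEQ[OF of_seq]]) auto
qed

lemma padic_norm_0 [simp]: "padic_norm (0 :: 'p::prime_card padic) = 0"
  using padic_norm_of_nat[of 0, where 'p = 'p] by simp

lemma padic_norm_1 [simp]: "padic_norm (1 :: 'p::prime_card padic) = 1"
  using padic_norm_of_nat[of 1, where 'p = 'p] by (simp add: prime_card)

lemma padic_norm_eq_0_iff [simp]: "padic_norm (x :: 'p::prime_card padic) = 0 \<longleftrightarrow> x = 0"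
proof (induction x)
  case (of_seq X)
  have "padic_of_seq X = (0 :: 'p padic)" if "padic_norm (padic_of_seq X :: 'p padic) = 0"
  proof -
    have "(\<lambda>n. rat_padic_norm CARD('p) (X n)) \<longlonglongrightarrow> 0"
      using padic_norm_LIMSEQ[OF of_seq] that by simp
    hence "padic_null CARD('p) X"
      unfolding padic_null_def lim_sequentially dist_real_def by simp
    thus ?thesis
      using of_seq by (simp add: zero_padic_def padic_of_seq_eq_iff prime_card)
  qed
  thus ?case by auto
qed

lemma padic_norm_mult: "padic_norm (x * y :: 'p::prime_card padic) = padic_norm x * padic_norm y"
proof (induction x; induction y)
  fix X Y assume X: "padic_cauchy CARD('p) X" and Y: "padic_cauchy CARD('p) Y"
  note lim = padic_norm_LIMSEQ[where 'p = 'p]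
  have "(\<lambda>n. rat_padic_norm CARD('p) (X n * Y n)) \<longlonglongrightarrow>
      padic_norm (padic_of_seq X :: 'p padic) * padic_norm (padic_of_seq Y :: 'p padic)"
    using tendsto_mult[OF lim[OF X] lim[OF Y]] by (simp add: rat_padic_norm_mult[OF prime_card])
  with lim[OF padic_cauchy_mult[OF prime_card X Y]]
  show "padic_norm (padic_of_seq X * padic_of_seq Y :: 'p padic) =
      padic_norm (padic_of_seq X :: 'p padic) * padic_norm (padic_of_seq Y :: 'p padic)"
    unfolding times_padic_of_seq[OF X Y] by (rule LIMSEQ_unique)
qed

lemma padic_norm_add_le_max:
  "padic_norm (x + y :: 'p::prime_card padic) \<le> max (padic_norm x) (padic_norm y)"
proof (induction x; induction y)
  fix X Y assume X: "padic_cauchy CARD('p) X" and Y: "padic_cauchy CARD('p) Y"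
  note lim = padic_norm_LIMSEQ[where 'p = 'p]
  show "padic_norm (padic_of_seq X + padic_of_seq Y :: 'p padic) \<le>
      max (padic_norm (padic_of_seq X :: 'p padic)) (padic_norm (padic_of_seq Y :: 'p padic))"
    unfolding plus_padic_of_seq[OF X Y]
    by (rule LIMSEQ_le[OF lim[OF padic_cauchy_add[OF prime_card X Y]]
          tendsto_max[OF lim[OF X] lim[OF Y]]])
      (auto intro: rat_padic_norm_add_le_max[OF prime_card])
qed

lemma padic_norm_minus [simp]: "padic_norm (- x :: 'p::prime_card padic) = padic_norm x"
proof -
  have "padic_norm (- 1 :: 'p padic) ^ 2 = 1"
    using padic_norm_mult[of "- 1 :: 'p padic" "- 1"] by (simp add: power2_eq_square)
  hence "padic_norm (- 1 :: 'p padic) = 1"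
    using padic_norm_nonneg[of "- 1 :: 'p padic"] by (simp add: power2_eq_1_iff)
  thus ?thesis using padic_norm_mult[of "- 1" x] by simp
qed

lemma padic_norm_diff_le_max:
  "padic_norm (x - y :: 'p::prime_card padic) \<le> max (padic_norm x) (padic_norm y)"
  using padic_norm_add_le_max[of x "- y"] by simp

lemma padic_norm_add_le:
  "padic_norm x \<le> c \<Longrightarrow> padic_norm y \<le> c \<Longrightarrow> padic_norm (x + y :: 'p::prime_card padic) \<le> c"
  using padic_norm_add_le_max[of x y] by linarith

lemma padic_norm_diff_le:
  "padic_norm x \<le> c \<Longrightarrow> padic_norm y \<le> c \<Longrightarrow> padic_norm (x - y :: 'p::prime_card padic) \<le> c"
  using padic_norm_diff_le_max[of x y] by linarith

lemma padic_norm_mult_le: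
  "padic_norm x \<le> c \<Longrightarrow> padic_norm y \<le> d \<Longrightarrow> padic_norm (x * y :: 'p::prime_card padic) \<le> c * d"
  unfolding padic_norm_mult by (intro mult_mono) (auto intro: order_trans[OF padic_norm_nonneg])

lemma padic_norm_mult_le_1:
  "padic_norm x \<le> 1 \<Longrightarrow> padic_norm y \<le> 1 \<Longrightarrow> padic_norm (x * y :: 'p::prime_card padic) \<le> 1"
  using padic_norm_mult_le[of x 1 y 1] by simp

lemma padic_norm_mult_le_right:
  "padic_norm x \<le> 1 \<Longrightarrow> padic_norm y \<le> c \<Longrightarrow> padic_norm (x * y :: 'p::prime_card padic) \<le> c"
  using padic_norm_mult_le[of x 1 y c] by simp

lemma padic_norm_mult_le_left:
  "padic_norm x \<le> c \<Longrightarrow> padic_norm y \<le> 1 \<Longrightarrow> padic_norm (x * y :: 'p::prime_card padic) \<le> c"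
  using padic_norm_mult_le[of x c y 1] by simp

lemma padic_norm_power: "padic_norm (x ^ n :: 'p::prime_card padic) = padic_norm x ^ n"
  by (induction n) (simp_all add: padic_norm_mult)

lemma padic_norm_inverse: "padic_norm (inverse x :: 'p::prime_card padic) = inverse (padic_norm x)"
proof (cases "x = 0")
  case False
  hence "padic_norm x * padic_norm (inverse x) = 1"
    by (simp flip: padic_norm_mult)
  thus ?thesis by (metis inverse_unique)
qed auto

lemma padic_norm_divide: "padic_norm (x / y :: 'p::prime_card padic) = padic_norm x / padic_norm y"
  by (simp add: divide_inverse padic_norm_mult padic_norm_inverse)

lemma padic_norm_sum_le:
  assumes "\<And>i. i \<in> I \<Longrightarrow> padic_norm (f i :: 'p::prime_card padic) \<le> c" "c \<ge> 0"
  shows "padic_norm (sum f I) \<le> c"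
  using assms by (induction I rule: infinite_finite_induct) (auto intro: padic_norm_add_le)

lemma padic_norm_prod_le_1:
  assumes "\<And>i. i \<in> I \<Longrightarrow> padic_norm (f i :: 'p::prime_card padic) \<le> 1"
  shows "padic_norm (prod f I) \<le> 1"
  using assms by (induction I rule: infinite_finite_induct) (auto intro: padic_norm_mult_le_1)

text \<open>Every ultrametric triangle is isosceles: since \<open>x = (x + y) - y\<close> and
  \<open>y\<close> is the smaller term, \<open>x + y\<close> cannot be smaller than
  \<open>x\<close>. This carries unit norms over from residues to their perturbations.\<close>

lemma padic_norm_add_eq_left:
  assumes "padic_norm y < padic_norm (x :: 'p::prime_card padic)"
  shows "padic_norm (x + y) = padic_norm x"
  using padic_norm_add_le_max[of x y] padic_norm_diff_le_max[of "x + y" y] assms by auto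

lemma padic_norm_of_int_le_1: "padic_norm (of_int n :: 'p::prime_card padic) \<le> 1"
proof -
  have "padic_norm (of_nat n :: 'p padic) \<le> 1" for n
    by (induction n) (auto intro: padic_norm_add_le)
  thus ?thesis by (cases n) (auto simp del: of_nat_Suc)
qed

lemma padic_norm_numeral_le_1: "padic_norm (numeral n :: 'p::prime_card padic) \<le> 1"
  using padic_norm_of_int_le_1[of "numeral n", where 'p = 'p] by simp

lemma padic_norm_of_int_le:
  assumes "int CARD('p) dvd n"
  shows "padic_norm (of_int n :: 'p::prime_card padic) \<le> 1 / real CARD('p)"
proof -
  obtain k where "n = int CARD('p) * k" using assms by blast
  hence "padic_norm (of_int n :: 'p padic) = padic_norm (of_nat CARD('p) :: 'p padic) * padic_norm (of_int k :: 'p padic)"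
    by (simp flip: padic_norm_mult)
  also have "\<dots> \<le> 1 / real CARD('p) * 1"
    unfolding padic_norm_prime by (intro mult_left_mono padic_norm_of_int_le_1) auto
  finally show ?thesis by simp
qed

text \<open>In a Bezout relation \<open>u * p + v * n = 1\<close> the first term has norm below 1,
  so the second has norm at least 1; as integers have norm at most 1, this leaves only norm 1 for
  \<open>n\<close>.\<close>

lemma padic_norm_of_int_eq_1:
  assumes "\<not> int CARD('p) dvd n"
  shows "padic_norm (of_int n :: 'p::prime_card padic) = 1"
proof -
  have "coprime (int CARD('p)) n"
    using assms prime_card_int[where 'a = 'p] by (simp add: prime_imp_coprime)
  then obtain u v where "u * int CARD('p) + v * n = 1"
    using bezout_int[of "int CARD('p)" n] by (auto simp: coprime_iff_gcd_eq_1)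
  hence "(1 :: 'p padic) = of_int (v * n) + of_int (u * int CARD('p))"
    by (metis add.commute of_int_1 of_int_add)
  hence *: "1 \<le> max (padic_norm (of_int (v * n) :: 'p padic)) (padic_norm (of_int (u * int CARD('p)) :: 'p padic))"
    using padic_norm_add_le_max[of "of_int (v * n) :: 'p padic" "of_int (u * int CARD('p))"] by simp
  have "padic_norm (of_int (u * int CARD('p)) :: 'p padic) \<le> 1 / real CARD('p)"
    by (intro padic_norm_of_int_le) simp
  also have "\<dots> < 1" using prime_gt_1_nat[OF prime_card[where 'a = 'p]] by simp
  finally have "1 \<le> padic_norm (of_int (v * n) :: 'p padic)" using * by linarith
  also have "\<dots> = padic_norm (of_int v :: 'p padic) * padic_norm (of_int n :: 'p padic)"
    by (simp add: padic_norm_mult)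
  also have "\<dots> \<le> 1 * padic_norm (of_int n :: 'p padic)"
    by (intro mult_right_mono padic_norm_of_int_le_1) auto
  finally show ?thesis
    using padic_norm_of_int_le_1[of n, where 'p = 'p] by simp
qed

lemma padic_norm_of_nat_eq_1:
  assumes "k > 0" "k < CARD('p)"
  shows "padic_norm (of_nat k :: 'p::prime_card padic) = 1"
proof -
  have "\<not> int CARD('p) dvd int k" using assms nat_dvd_not_less by simp
  from padic_norm_of_int_eq_1[OF this] show ?thesis by simp
qed

lemma padic_norm_add_less:
  "padic_norm x < c \<Longrightarrow> padic_norm y < c \<Longrightarrow> padic_norm (x + y :: 'p::prime_card padic) < c"
  using padic_norm_add_le_max[of x y] by linarith

lemma padic_norm_mult_less_1:
  "padic_norm x < 1 \<Longrightarrow> padic_norm y \<le> 1 \<Longrightarrow> padic_norm (x * y :: 'p::prime_card padic) < 1"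
  using padic_norm_mult_le_left[of x "padic_norm x" y] by simp

lemma padic_norm_of_nat_le_1: "padic_norm (of_nat n :: 'p::prime_card padic) \<le> 1"
  using padic_norm_of_int_le_1[of "int n", where 'p = 'p] by simp

lemma padic_norm_power_le_1: "padic_norm x \<le> 1 \<Longrightarrow> padic_norm (x ^ n :: 'p::prime_card padic) \<le> 1"
  by (simp add: padic_norm_power power_le_one)

lemmas padic_integral_intros = padic_norm_add_le padic_norm_diff_le padic_norm_mult_le_1
  padic_norm_power_le_1 padic_norm_numeral_le_1 padic_norm_of_nat_le_1

text \<open>Naturals keep their rational norm, which vanishes only at 0. In particular
  \<open>of_nat q\<close> is nonzero, and this is the normalizing factor at the root for the
  boundary value 1.\<close>

instance padic :: (prime_card) field_char_0
proof (standard, intro injI)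
  fix m n :: nat assume "(of_nat m :: 'a padic) = of_nat n"
  hence "padic_norm (of_nat (m - n) :: 'a padic) = 0" "padic_norm (of_nat (n - m) :: 'a padic) = 0"
    by (cases "m \<le> n"; simp add: of_nat_diff)+
  hence "(of_nat (m - n) :: rat) = 0" "(of_nat (n - m) :: rat) = 0"
    unfolding padic_norm_of_nat by (simp_all only: rat_padic_norm_eq_0_iff[OF prime_card])
  thus "m = n" by simp
qed

section \<open>The p-adic metric, completeness and lifting of simple roots\<close>

instantiation padic :: (prime_card) metric_space
begin

definition dist_padic :: "'a padic \<Rightarrow> 'a padic \<Rightarrow> real" where
  "dist_padic x y = padic_norm (x - y)"

definition uniformity_padic :: "('a padic \<times> 'a padic) filter" where
  "uniformity_padic = (INF e\<in>{0<..}. principal {(x, y). dist x y < e})"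

definition open_padic :: "'a padic set \<Rightarrow> bool" where
  "open_padic U \<longleftrightarrow> (\<forall>x\<in>U. eventually (\<lambda>(x', y). x' = x \<longrightarrow> y \<in> U) uniformity)"

instance
proof
  fix x y z :: "'a padic"
  show "dist x y = 0 \<longleftrightarrow> x = y" by (simp add: dist_padic_def)
  have "padic_norm (x - y) \<le> max (padic_norm (x - z)) (padic_norm (y - z))"
    using padic_norm_diff_le_max[of "x - z" "y - z"] by simp
  also have "\<dots> \<le> padic_norm (x - z) + padic_norm (y - z)"
    by simp
  finally show "dist x y \<le> dist x z + dist y z"
    unfolding dist_padic_def .
qed (auto simp: uniformity_padic_def open_padic_def)

end

lemma dist_padic_of_seq_const:
  "dist (padic_of_seq (\<lambda>_. r)) (padic_of_seq (\<lambda>_. s) :: 'p::prime_card padic) =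
     rat_padic_norm CARD('p) (r - s)"
proof -
  note p = prime_card[where 'a = 'p]
  have "padic_of_seq (\<lambda>_. r) - padic_of_seq (\<lambda>_. s) = (padic_of_seq (\<lambda>_. r + - s) :: 'p padic)"
    unfolding minus_padic_def by (simp add: uminus_padic_of_seq plus_padic_of_seq p)
  thus ?thesis by (simp add: dist_padic_def padic_norm_of_seq p)
qed

lemma padic_of_seq_LIMSEQ:
  assumes X: "padic_cauchy CARD('p) X"
  shows "(\<lambda>n. padic_of_seq (\<lambda>_. X n)) \<longlonglongrightarrow> (padic_of_seq X :: 'p::prime_card padic)"
proof (rule metric_LIMSEQ_I)
  fix e :: real assume e: "e > 0"
  \<comment> \<open>The norm of a class is a limit, through which only the weak inequality survives;
    the slack makes the final bound strict.\<close>
  hence "e / 2 > 0" by simp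
  then obtain k where k: "\<forall>m\<ge>k. \<forall>n\<ge>k. rat_padic_norm CARD('p) (X m - X n) < e / 2"
    using X unfolding padic_cauchy_def by blast
  note p = prime_card[where 'a = 'p]
  have "dist (padic_of_seq (\<lambda>_. X n)) (padic_of_seq X :: 'p padic) < e" if "n \<ge> k" for n
  proof -
    have c: "padic_cauchy CARD('p) (\<lambda>m. X m + - X n)"
      by (rule padic_cauchy_add[OF p X]) (simp add: p)
    have "padic_of_seq X - padic_of_seq (\<lambda>_. X n) = (padic_of_seq (\<lambda>m. X m + - X n) :: 'p padic)"
      unfolding minus_padic_def by (simp add: uminus_padic_of_seq plus_padic_of_seq X p)
    moreover have "padic_norm (padic_of_seq (\<lambda>m. X m + - X n) :: 'p padic) \<le> e / 2"
      by (rule LIMSEQ_le_const2[OF padic_norm_LIMSEQ[OF c]])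
        (use k that in \<open>auto intro!: exI[of _ k] less_imp_le\<close>)
    ultimately show ?thesis
      using e by (subst dist_commute) (simp add: dist_padic_def)
  qed
  thus "\<exists>k. \<forall>n\<ge>k. dist (padic_of_seq (\<lambda>_. X n)) (padic_of_seq X :: 'p padic) < e" by blast
qed

lemma rat_approx_padic:
  fixes x :: "'p::prime_card padic"
  assumes "e > 0"
  shows "\<exists>r. dist x (padic_of_seq (\<lambda>_. r)) < e"
proof (induction x)
  case (of_seq X)
  show ?case
    using metric_LIMSEQ_D[OF padic_of_seq_LIMSEQ[OF of_seq] assms] by (metis dist_commute order_refl)
qed

text \<open>Each term of a Cauchy sequence is replaced by a rational constant at distance below
  \<open>1 / 2 ^ n\<close>. These rationals form a p-adic Cauchy sequence, whose class is the limit
  of both sequences.\<close>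

instance padic :: (prime_card) complete_space
proof
  fix x :: "nat \<Rightarrow> 'a padic" assume x: "Cauchy x"
  have "\<exists>r. dist (x n) (padic_of_seq (\<lambda>_. r)) < 1 / 2 ^ n" for n
    by (rule rat_approx_padic) simp
  then obtain r where r: "\<And>n. dist (x n) (padic_of_seq (\<lambda>_. r n)) < 1 / 2 ^ n" by metis
  define y where "y n = (padic_of_seq (\<lambda>_. r n) :: 'a padic)" for n
  have "(\<lambda>n. dist (x n) (y n)) \<longlonglongrightarrow> 0"
  proof (rule Lim_null_comparison)
    show "\<forall>\<^sub>F n in sequentially. norm (dist (x n) (y n)) \<le> (1 / 2) ^ n"
      using less_imp_le[OF r] by (simp add: y_def power_divide)
  qed (rule LIMSEQ_power_zero, simp)
  hence xy: "(\<lambda>n. dist (y n) (x n)) \<longlonglongrightarrow> 0" by (simp add: dist_commute)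
  have "Cauchy y"
  proof (rule metric_CauchyI)
    fix e :: real assume "e > 0"
    hence e: "e / 3 > 0" by simp
    obtain i where i: "\<And>m n. m \<ge> i \<Longrightarrow> n \<ge> i \<Longrightarrow> dist (x m) (x n) < e / 3"
      using metric_CauchyD[OF x e] by blast
    obtain j where j: "\<And>n. n \<ge> j \<Longrightarrow> dist (y n) (x n) < e / 3"
      using metric_LIMSEQ_D[OF xy e] by auto
    have "dist (y m) (y n) < e" if "m \<ge> max i j" "n \<ge> max i j" for m n
      using i[of m n] j[of m] j[of n] that
        dist_triangle[of "y m" "y n" "x m"] dist_triangle2[of "x m" "y n" "x n"] by auto
    thus "\<exists>k. \<forall>m\<ge>k. \<forall>n\<ge>k. dist (y m) (y n) < e" by blast
  qed
  hence "padic_cauchy CARD('a) r"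
    unfolding padic_cauchy_def Cauchy_def y_def dist_padic_of_seq_const .
  hence "y \<longlonglongrightarrow> padic_of_seq r" unfolding y_def by (rule padic_of_seq_LIMSEQ)
  hence "(\<lambda>n. dist (y n) (x n) + dist (y n) (padic_of_seq r)) \<longlonglongrightarrow> 0 + 0"
    by (intro tendsto_add xy iffD1[OF tendsto_dist_iff])
  hence "(\<lambda>n. dist (x n) (padic_of_seq r)) \<longlonglongrightarrow> 0"
    by (intro Lim_null_comparison[of "\<lambda>n. dist (x n) (padic_of_seq r)"] always_eventually)
      (auto intro: dist_triangle3)
  hence "x \<longlonglongrightarrow> padic_of_seq r" by (rule iffD2[OF tendsto_dist_iff])
  thus "convergent x" by (rule convergentI)
qed

text \<open>Newton's iteration with the derivative frozen at the starting point is a contraction.\<close>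

lemma padic_hensel_cubic:
  fixes a b c :: "'p::prime_card padic"
  defines "g \<equiv> \<lambda>x. x ^ 3 + a * x ^ 2 + b * x + c"
  defines "g' \<equiv> \<lambda>x. 3 * x ^ 2 + 2 * a * x + b"
  assumes a: "padic_norm a \<le> 1"
    and x0: "padic_norm x0 \<le> 1" "padic_norm (g x0) < 1" and g': "padic_norm (g' x0) = 1"
  shows "\<exists>x. g x = 0 \<and> padic_norm (x - x0) < 1"
proof -
  \<comment> \<open>The same \<open>r\<close> serves as the radius of the ball around
    \<open>x0\<close> and as the contraction constant.\<close>
  define r where "r = padic_norm (g x0)"
  define T where "T x = x - g x / g' x0" for x
  have d0: "g' x0 \<noteq> 0" using g' by auto
  have r: "0 \<le> r" "r < 1" using x0 by (simp_all add: r_def)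
  have contr: "dist (T x) (T y) \<le> r * dist x y" if "dist x0 x \<le> r" "dist x0 y \<le> r" for x y
  proof -
    define s t where "s = x - x0" and "t = y - x0"
    have st: "padic_norm s \<le> r" "padic_norm t \<le> r"
      using that unfolding s_def t_def dist_commute[of x0] by (simp_all add: dist_padic_def)
    hence st1: "padic_norm s \<le> 1" "padic_norm t \<le> 1" using r by auto
    have xy: "x = x0 + s" "y = x0 + t" by (simp_all add: s_def t_def)
    \<comment> \<open>\<open>k\<close> is the error made by taking \<open>g' x0\<close> for the
      difference quotient of \<open>g\<close>. Each of its terms contains \<open>s\<close> or
      \<open>t\<close>, so its norm is at most \<open>r\<close>.\<close>
    define k where "k = s * (3 * x0 + s + t + a) + t * (3 * x0 + t + a)"
    have eq: "g x - g y = (x - y) * (g' x0 + k)"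
      unfolding g_def g'_def k_def xy
      by (simp add: algebra_simps power2_eq_square power3_eq_cube)
    have "T x - T y = (x - y) - (g x - g y) / g' x0"
      by (simp add: T_def diff_divide_distrib)
    also have "\<dots> = - ((x - y) * k / g' x0)"
      unfolding eq using d0 by (simp add: field_simps)
    finally have "padic_norm (T x - T y) = padic_norm (x - y) * padic_norm k"
      by (simp add: padic_norm_divide padic_norm_mult g')
    moreover have "padic_norm k \<le> r"
      unfolding k_def using st st1 a x0 padic_norm_numeral_le_1
      by (intro padic_norm_add_le padic_norm_mult_le_left padic_norm_mult_le_1) auto
    ultimately show ?thesis
      by (simp add: dist_padic_def mult.commute mult_right_mono)
  qed
  have self: "dist x0 (T x) \<le> r" if "dist x0 x \<le> r" for x
  proof -
    have "padic_norm (x0 - T x0) \<le> r"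
      by (simp add: T_def padic_norm_divide g' r_def)
    moreover have "padic_norm (T x0 - T x) \<le> r"
    proof -
      have "dist (T x0) (T x) \<le> r * dist x0 x" using that r by (intro contr) auto
      also have "\<dots> \<le> 1 * r" using that r by (intro mult_mono) auto
      finally show ?thesis by (simp add: dist_padic_def)
    qed
    ultimately have "padic_norm ((x0 - T x0) + (T x0 - T x)) \<le> r" by (rule padic_norm_add_le)
    thus ?thesis by (simp add: dist_padic_def)
  qed
  have "\<exists>!x\<in>cball x0 r. T x = x"
    by (rule Banach_fix[of _ r]) (use r self contr in \<open>auto simp: complete_eq_closed\<close>)
  then obtain x where x: "dist x0 x \<le> r" "T x = x" by auto
  have "g x = 0" using x(2) d0 by (simp add: T_def)
  moreover have "padic_norm (x - x0) < 1"
    using x(1) r unfolding dist_commute[of x0] by (simp add: dist_padic_def)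
  ultimately show ?thesis by blast
qed

section \<open>Roots of the cubic modulo p\<close>

text \<open>
  Here \<open>c0, c1, c2\<close> are the coefficients of a polynomial \<open>R\<close> of degree at most two; the three
  equations say that \<open>R\<^sup>2 + R X + X\<^sup>2 + a\<close> vanishes modulo \<open>X\<^sup>3 + a X - b\<close>.
\<close>

lemma cubic_conjugate_leading_coeff:
  fixes a b c0 c1 c2 :: "'a::field"
  assumes two: "(2 :: 'a) \<noteq> 0" and three: "(3 :: 'a) \<noteq> 0" and a: "a \<noteq> 0"
    and e2: "- a * c2 ^ 2 + c1 ^ 2 + 2 * c0 * c2 + c1 + 1 = 0"
    and e1: "b * c2 ^ 2 - 2 * a * c1 * c2 + 2 * c0 * c1 - a * c2 + c0 = 0"
    and e0: "2 * b * c1 * c2 + c0 ^ 2 + b * c2 + a = 0"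
    and no_root: "\<And>y. y ^ 3 + a * y \<noteq> b"
  shows "(- 4 * a ^ 3 - 27 * b ^ 2) * c2 ^ 2 = 9 * a ^ 2"
proof -
  \<comment> \<open>\<open>s\<close> completes the square in \<open>e2\<close>. \<open>t\<close> is
    the trace of R: the roots of the cubic have power sums 3, 0 and \<open>- 2 * a\<close> in
    degrees 0, 1 and 2.\<close>
  define s t where "s = 2 * c1 + 1" and "t = 3 * c0 - 2 * a * c2"
  have b: "b \<noteq> 0" using no_root[of 0] by auto
  have s2: "s ^ 2 = 4 * a * c2 ^ 2 - 8 * c0 * c2 - 3"
    unfolding s_def using e2 by Groebner_Basis.algebra
  have s1: "b * c2 ^ 2 + (c0 - a * c2) * s = 0"
    unfolding s_def using e1 by Groebner_Basis.algebra
  have s0: "b * c2 * s + c0 ^ 2 + a = 0"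
    unfolding s_def using e0 by Groebner_Basis.algebra
  have "t * (c2 * t + 1) = 0"
    unfolding t_def using s2 s1 s0 by Groebner_Basis.algebra
  hence "t = 0 \<or> c2 * t = - 1" by (auto simp: eq_neg_iff_add_eq_0)
  thus ?thesis
  proof
    \<comment> \<open>This is the case of a permutation of the roots: the trace is then the sum of
      the roots, which is 0. Both \<open>c0\<close> and \<open>s\<close> become multiples of
      \<open>c2\<close>, and \<open>s0\<close> turns into the claim.\<close>
    assume t: "t = 0"
    have c0: "3 * c0 = 2 * a * c2" using t by (simp add: t_def)
    have c2: "c2 \<noteq> 0"
    proof
      assume "c2 = 0"
      hence "c0 = 0" using c0 three by simp
      thus False using s0 \<open>c2 = 0\<close> a by simp
    qed
    have "c2 * (3 * b * c2 - a * s) = 0" using s1 c0 by Groebner_Basis.algebra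
    hence "3 * b * c2 = a * s" using c2 by simp
    thus ?thesis using s0 c0 by Groebner_Basis.algebra
  next
    \<comment> \<open>Here \<open>R\<close> maps the roots to themselves without being a permutation, and its trace \<open>t\<close> is a
      difference of two roots. A common root of \<open>y\<^sup>3 + a y - b\<close> and \<open>(y + t)\<^sup>3 + a (y + t) - b\<close> is
      then rational; eliminating yields the \<open>y\<close> below.\<close>
    assume t: "c2 * t = - 1"
    define m where "m = t ^ 2 + a"
    have c2: "c2 \<noteq> 0" and t0: "t \<noteq> 0" using t by auto
    have c0: "3 * c0 = t + 2 * a * c2" by (simp add: t_def)
    have "3 * b = - m * s * t" 
    proof -
      have "c2 ^ 2 * (3 * b + m * s * t) = 3 * b * c2 ^ 2 + s * t * (c2 * t) ^ 2 + a * s * c2 * (c2 * t)"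
        unfolding m_def by Groebner_Basis.algebra
      also have "\<dots> = 3 * b * c2 ^ 2 + (t - a * c2) * s"
        unfolding t by Groebner_Basis.algebra
      also have "\<dots> = 0" using s1 c0 by Groebner_Basis.algebra
      finally have "c2 ^ 2 * (3 * b + m * s * t) = 0" .
      thus ?thesis using c2 by (simp add: eq_neg_iff_add_eq_0)
    qed
    moreover have "3 * s ^ 2 * t ^ 2 = - (t ^ 2 + 4 * a)"
    proof -
      have "3 * s ^ 2 + 1 + 4 * a * c2 ^ 2 = 0" using s2 c0 t by Groebner_Basis.algebra
      thus ?thesis using t by Groebner_Basis.algebra
    qed
    ultimately have b2: "27 * b ^ 2 = - (m ^ 2) * (t ^ 2 + 4 * a)" by Groebner_Basis.algebra
    have m: "m \<noteq> 0"
    proof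
      assume "m = 0"
      hence "3 ^ 3 * b ^ 2 = 0" using b2 by simp
      moreover have "(3 :: 'a) ^ 3 * b ^ 2 \<noteq> 0" using three b by (simp only: power_eq_0_iff mult_eq_0_iff) simp
      ultimately show False by blast
    qed
    define y where "y = (3 * b - t * m) / (2 * m)"
    have y: "2 * m * y = 3 * b - t * m" using two m by (simp add: y_def)
    have "(2 * m) ^ 3 * (y ^ 3 + a * y - b) = 0"
      using y b2 unfolding m_def by Groebner_Basis.algebra
    moreover have "(2 * m) ^ 3 \<noteq> 0" using two m by (simp only: power_eq_0_iff mult_eq_0_iff) simp
    ultimately have "y ^ 3 + a * y = b" by simp
    thus ?thesis using no_root by blast
  qed
qed

section \<open>The cubic over the prime field: irreducibility, powers of X and Frobenius\<close>

lemma irreducible_cubic: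
  fixes a b :: "'a::field"
  assumes "\<And>y. y ^ 3 + a * y \<noteq> b"
  shows "irreducible [:- b, a, 0, 1:]"
proof (rule irreducibleI)
  show "\<not> [:- b, a, 0, 1:] dvd 1" by (auto simp: poly_dvd_1)
  fix g h assume gh: "[:- b, a, 0, 1:] = g * h"
  have nz: "g \<noteq> 0" "h \<noteq> 0" using gh by auto
  have deg: "degree g + degree h = 3"
    using degree_mult_eq[OF nz] gh by (simp flip: gh)
  have no: "degree k \<noteq> 1" if dvd: "k dvd [:- b, a, 0, 1:]" for k
  proof
    assume "degree k = 1"
    then obtain c d where k: "k = [:c, d:]" "d \<noteq> 0"
      by (metis degree1_coeffs)
    hence "poly k (- c / d) = 0" by simp
    moreover obtain j where "[:- b, a, 0, 1:] = k * j" using dvd by blast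
    ultimately have "poly [:- b, a, 0, 1:] (- c / d) = 0"
      by (simp only: poly_mult mult_zero_left)
    hence "- b + ((- c / d) ^ 3 + a * (- c / d)) = 0"
      by (simp add: algebra_simps power3_eq_cube)
    hence "(- c / d) ^ 3 + a * (- c / d) = b"
      by (simp only: neg_eq_iff_add_eq_0 minus_minus add_eq_0_iff)
    thus False using assms by blast
  qed
  have "degree g \<noteq> 1" "degree h \<noteq> 1" using no[of g] no[of h] gh by auto
  hence "degree g = 0 \<or> degree h = 0" using deg by linarith
  thus "g dvd 1 \<or> h dvd 1" using nz by (auto simp: is_unit_iff_degree)
qed simp

text \<open>Multiplying a remainder by X and replacing \<open>X ^ 3\<close> by
  \<open>b - a X\<close> reproduces the recurrence. Thus \<open>u n\<close> is the coefficient of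
  \<open>X ^ 2\<close> in the remainder of \<open>X ^ (n + 2)\<close>.\<close>

lemma cubic_power_cong:
  fixes a b :: "'a::field" and u :: "nat \<Rightarrow> 'a"
  assumes u: "u 1 = 0" "u 2 = - a" "u 3 = b"
    and rec: "\<And>n. n \<ge> 1 \<Longrightarrow> u (n + 3) = b * u n - a * u (n + 1)"
    and n: "n \<ge> 1"
  shows "[:- b, a, 0, 1:] dvd [:0, 1:] ^ (n + 2) - [:u (n + 2) + a * u n, u (n + 1), u n:]"
  using n
proof (induction n rule: dec_induct)
  case base
  show ?case using u by (simp add: numeral_eq_Suc)
next
  case (step n)
  let ?f = "[:- b, a, 0, 1:]"
  let ?r = "\<lambda>n. [:u (n + 2) + a * u n, u (n + 1), u n:]"
  have "[:0, 1:] ^ (Suc n + 2) - ?r (Suc n) =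
      [:0, 1:] * ([:0, 1:] ^ (n + 2) - ?r n) + [:u n:] * ?f"
    using rec[OF step(1)] by (simp add: algebra_simps numeral_eq_Suc)
  moreover have "?f dvd \<dots>" by (intro dvd_add dvd_mult step.IH) simp
  ultimately show ?case by simp
qed


lemma pcompose_cubic:
  "[:- b, a, 0, 1:] \<circ>\<^sub>p R = [:- b:] + [:a:] * R + R ^ 3" for a b :: "'a::field"
  by (simp add: pcompose_pCons algebra_simps power3_eq_cube)

text \<open>Taking p-th powers is additive in characteristic p and fixes the coefficients by Fermat.
  Hence the cubic vanishes at \<open>X ^ p\<close> modulo itself.\<close>

lemma cubic_frobenius:
  fixes a b :: "'p::prime_card mod_ring"
  shows "[:- b, a, 0, 1:] ^ CARD('p) = [:- b, a, 0, 1:] \<circ>\<^sub>p ([:0, 1:] ^ CARD('p))"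
proof -
  let ?X = "[:0, 1:] :: 'p mod_ring poly"
  have fd: "(x + y) ^ CARD('p) = x ^ CARD('p) + y ^ CARD('p)" for x y :: "'p mod_ring poly"
    by (rule freshmans_dream) (simp_all add: prime_card)
  have c: "[:k:] ^ CARD('p) = [:k:]" for k :: "'p mod_ring"
    by (simp add: poly_const_pow)
  have "[:- b, a, 0, 1:] = [:- b:] + [:a:] * ?X + ?X ^ 3"
    by (simp add: power3_eq_cube)
  hence "[:- b, a, 0, 1:] ^ CARD('p) = [:- b:] + [:a:] * ?X ^ CARD('p) + (?X ^ CARD('p)) ^ 3"
    by (simp only: fd c power_mult_distrib power_mult[symmetric] mult.commute[of 3])
  thus ?thesis by (simp only: pcompose_cubic)
qed

text \<open>\<open>X ^ p - X\<close> is the product of all monic linear polynomials over the prime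
  field, and an irreducible divisor, being prime, would divide one of them.\<close>

lemma irreducible_not_dvd_frobenius_fixed:
  fixes f :: "'p::prime_card mod_ring poly"
  assumes "irreducible f" and "degree f \<ge> 2"
  shows "\<not> f dvd [:0, 1:] ^ CARD('p) - [:0, 1:]"
proof
  assume "f dvd [:0, 1:] ^ CARD('p) - [:0, 1:]"
  also have "[:0, 1:] ^ CARD('p) - [:0, 1:] = (\<Prod>x\<in>UNIV. [:0, 1:] - [:x :: 'p mod_ring:])"
    by (rule poly_identity_mod_p)
  also have "\<dots> = prod_mset (image_mset (\<lambda>x. [:0, 1:] - [:x:]) (mset_set UNIV))"
    by (rule prod_unfold_prod_mset)
  finally obtain x where "f dvd [:- x, 1:]"
    by (rule prime_elem_dvd_prod_msetE[OF irreducible_imp_prime_elem[OF assms(1)]]) auto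
  hence "degree f \<le> degree [:- x, 1:]" by (rule dvd_imp_degree_le) simp
  thus False using assms(2) by simp
qed

lemma of_nat_mod_ring_neq_0:
  assumes "k > 0" "k < CARD('p)"
  shows "(of_nat k :: 'p::prime_card mod_ring) \<noteq> 0"
  using of_nat_0_mod_ring_dvd[of k, where 'a = 'p] nat_dvd_not_less[OF assms] by blast

text \<open>
  If the cubic has no root then it is irreducible, so \<open>X ^ p\<close> is a root other than \<open>X\<close>
  modulo \<open>X\<^sup>3 + a X - b\<close>, and \<open>u (p - 2)\<close> is its leading coefficient.
\<close>

lemma cubic_has_root_mod_p:
  fixes a b :: "'p::prime_card mod_ring" and u :: "nat \<Rightarrow> 'p mod_ring"
  assumes p: "CARD('p) > 3" and a: "a \<noteq> 0"
    and u: "u 1 = 0" "u 2 = - a" "u 3 = b"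
    and rec: "\<And>n. n \<ge> 1 \<Longrightarrow> u (n + 3) = b * u n - a * u (n + 1)"
    and ne: "(- 4 * a ^ 3 - 27 * b ^ 2) * u (CARD('p) - 2) ^ 2 \<noteq> 9 * a ^ 2"
  shows "\<exists>y. y ^ 3 + a * y = b"
proof (rule ccontr)
  assume "\<not> ?thesis"
  hence no_root: "\<And>y. y ^ 3 + a * y \<noteq> b" by blast
  define f where "f = [:- b, a, 0, 1:]"
  define X where "X = ([:0, 1:] :: 'p mod_ring poly)"
  \<comment> \<open>The index is shifted by 2 in \<open>cubic_power_cong\<close>, so this choice
    describes the remainder of \<open>X ^ p\<close>.\<close>
  define n where "n = CARD('p) - 2"
  define c0 c1 c2 where "c0 = u (n + 2) + a * u n" and "c1 = u (n + 1)" and "c2 = u n"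
  define R where "R = [:c0, c1, c2:]"
  have n: "n \<ge> 1" "n + 2 = CARD('p)" using p by (auto simp: n_def)
  have irr: "irreducible f" unfolding f_def by (rule irreducible_cubic) (rule no_root)
  have XR: "f dvd X ^ CARD('p) - R"
    using cubic_power_cong[of u a b n] u rec n
    unfolding f_def X_def R_def c0_def c1_def c2_def by metis
  have "f dvd f \<circ>\<^sub>p (X ^ CARD('p))"
    unfolding f_def X_def cubic_frobenius[symmetric] by (rule dvd_power) simp
  moreover have "f dvd f \<circ>\<^sub>p (X ^ CARD('p)) - f \<circ>\<^sub>p R"
  proof -
    have "B + A * P + P ^ 3 - (B + A * Q + Q ^ 3) = (P - Q) * (P ^ 2 + P * Q + Q ^ 2 + A)"
      for A B P Q :: "'p mod_ring poly"
      by Groebner_Basis.algebra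
    thus ?thesis using XR unfolding f_def pcompose_cubic by (simp only: dvd_mult2)
  qed
  ultimately have "f dvd f \<circ>\<^sub>p R" by (metis dvd_diff diff_diff_eq2 add_diff_cancel_left')
  \<comment> \<open>The value of the cubic at X is \<open>f\<close> itself, so its value at R
    differs from \<open>f\<close> by a multiple of \<open>R - X\<close>. The cofactor is the
    polynomial whose vanishing modulo \<open>f\<close> feeds
    \<open>cubic_conjugate_leading_coeff\<close>.\<close>
  moreover have "f \<circ>\<^sub>p R = f + (R - X) * (R ^ 2 + R * X + X ^ 2 + [:a:])"
  proof -
    have "f = [:- b:] + [:a:] * X + X ^ 3"
      unfolding f_def X_def by (simp add: power3_eq_cube)
    moreover have "f \<circ>\<^sub>p R = [:- b:] + [:a:] * R + R ^ 3"
      unfolding f_def by (rule pcompose_cubic)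
    ultimately show ?thesis by Groebner_Basis.algebra
  qed
  ultimately have "f dvd (R - X) * (R ^ 2 + R * X + X ^ 2 + [:a:])"
    by (simp add: dvd_add_right_iff)
  moreover have "\<not> f dvd R - X"
  proof
    assume "f dvd R - X"
    with XR have "f dvd (X ^ CARD('p) - R) + (R - X)" by (rule dvd_add)
    hence "f dvd X ^ CARD('p) - X" by simp
    thus False
      using irreducible_not_dvd_frobenius_fixed[OF irr] by (simp add: f_def X_def)
  qed
  ultimately have "f dvd R ^ 2 + R * X + X ^ 2 + [:a:]"
    using irr by (metis irreducible_imp_prime_elem prime_elem_dvd_mult_iff)
  \<comment> \<open>\<open>r\<close> is the remainder on division by \<open>f\<close>, with the
    quotient displayed below. Having degree at most 2, it must vanish, and its coefficients are the
    three required equations.\<close>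
  define r where "r = [:2 * b * c1 * c2 + c0 ^ 2 + b * c2 + a,
     b * c2 ^ 2 - 2 * a * c1 * c2 + 2 * c0 * c1 - a * c2 + c0,
     - a * c2 ^ 2 + c1 ^ 2 + 2 * c0 * c2 + c1 + 1:]"
  have "R ^ 2 + R * X + X ^ 2 + [:a:] = f * [:2 * c1 * c2 + c2, c2 ^ 2:] + r"
    unfolding R_def X_def f_def r_def
    by (simp add: algebra_simps power2_eq_square, simp only: one_pCons add_pCons add_0_left)
  with \<open>f dvd R ^ 2 + R * X + X ^ 2 + [:a:]\<close> have "f dvd r"
    by (metis dvd_add_right_iff dvd_triv_left)
  moreover have "degree r < degree f"
  proof -
    have "degree r \<le> 2" unfolding r_def by simp
    thus ?thesis by (simp add: f_def)
  qed
  ultimately have "r = 0" by (meson dvd_imp_degree_le not_less)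
  hence e: "2 * b * c1 * c2 + c0 ^ 2 + b * c2 + a = 0"
     "b * c2 ^ 2 - 2 * a * c1 * c2 + 2 * c0 * c1 - a * c2 + c0 = 0"
     "- a * c2 ^ 2 + c1 ^ 2 + 2 * c0 * c2 + c1 + 1 = 0"
    unfolding r_def by simp_all
  have "(2 :: 'p mod_ring) \<noteq> 0" "(3 :: 'p mod_ring) \<noteq> 0"
    using of_nat_mod_ring_neq_0[of 2, where 'p = 'p] of_nat_mod_ring_neq_0[of 3, where 'p = 'p] p by auto
  from cubic_conjugate_leading_coeff[OF this a e(3,2,1) no_root]
  show False using ne by (simp add: c2_def n_def)
qed

section \<open>A simple root of the reduced cubic\<close>

lemma of_int_mod_ring_eq_0_iff:
  "(of_int n :: 'p::prime_card mod_ring) = 0 \<longleftrightarrow> int CARD('p) dvd n"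
  by (simp add: of_int_eq_0_iff_char_dvd)

text \<open>
  The discriminant is \<open>- 44\<close>; the multipliers in the proof come from the Euclidean algorithm for the
  cubic and its derivative.
\<close>

lemma fixed_point_cubic_squarefree_mod_p:
  fixes p x :: int
  assumes "prime p" "p > 3" "p \<noteq> 11" "p dvd x ^ 3 - 5 * x ^ 2 + 7 * x - 1"
  shows "\<not> p dvd 3 * x ^ 2 - 10 * x + 7"
proof
  assume "p dvd 3 * x ^ 2 - 10 * x + 7"
  hence "p dvd (3 * x ^ 2 - 10 * x + 7) * (64 - (3 * x - 5) * (24 * x - 2)) +
      (x ^ 3 - 5 * x ^ 2 + 7 * x - 1) * (9 * (24 * x - 2))"
    using assms(4) by (simp only: dvd_add dvd_mult2)
  also have "\<dots> = 2 ^ 2 * 3 ^ 2 * 11"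
    by Groebner_Basis.algebra
  finally have "p dvd 2 \<or> p dvd 3 \<or> p dvd 11"
    using assms(1) prime_dvd_power[of p 2 2] prime_dvd_power[of p 3 2]
    by (simp only: prime_dvd_mult_iff) blast
  moreover have "prime (2 :: int)" "prime (3 :: int)" "prime (11 :: int)" by simp_all
  ultimately have "p = 2 \<or> p = 3 \<or> p = 11"
    using primes_dvd_imp_eq[OF assms(1)] by blast
  thus False using assms(2,3) by simp
qed

lemma fixed_point_cubic_root_mod_p:
  fixes a\<^sub>0 b\<^sub>0 D\<^sub>0 :: int and u :: "nat \<Rightarrow> int"
  defines "p \<equiv> CARD('p::prime_card)"
  assumes p: "p > 3"
    and cases: "p = 11 \<or> p = 19 \<or>
      (p \<noteq> 11 \<and> [3 * a\<^sub>0 = - 4] (mod int p) \<and> [27 * b\<^sub>0 = - 38] (mod int p) \<and>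
       D\<^sub>0 = - 4 * a\<^sub>0 ^ 3 - 27 * b\<^sub>0 ^ 2 \<and>
       u 1 = 0 \<and> u 2 = - a\<^sub>0 \<and> u 3 = b\<^sub>0 \<and>
       (\<forall>n\<ge>1. u (n + 3) = b\<^sub>0 * u n - a\<^sub>0 * u (n + 1)) \<and>
       \<not> [D\<^sub>0 * u (p - 2) ^ 2 = 9 * a\<^sub>0 ^ 2] (mod int p))"
  shows "\<exists>x. int p dvd x ^ 3 - 5 * x ^ 2 + 7 * x - 1 \<and> \<not> int p dvd 3 * x ^ 2 - 10 * x + 7"
proof -
  have prime: "prime (int p)" unfolding p_def by (rule prime_card_int)
  consider "p = 11" | "p = 19" | "p \<noteq> 11" "\<not> p = 19" using cases by blast
  thus ?thesis
  proof cases
    case 1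
    \<comment> \<open>Modulo 11 the cubic is \<open>(x - 4) * (x - 6) ^ 2\<close>, so only 4 can be
      lifted.\<close>
    thus ?thesis by (intro exI[of _ 4]) simp
  next
    case 2
    \<comment> \<open>As 19 divides 38, the depressed cubic has the root 0 modulo 19; undoing the
      shift gives \<open>5 / 3\<close>, which is 8 there.\<close>
    thus ?thesis by (intro exI[of _ 8]) simp
  next
    case 3
    have h: "[3 * a\<^sub>0 = - 4] (mod int p)" "[27 * b\<^sub>0 = - 38] (mod int p)"
        "D\<^sub>0 = - 4 * a\<^sub>0 ^ 3 - 27 * b\<^sub>0 ^ 2" "u 1 = 0" "u 2 = - a\<^sub>0" "u 3 = b\<^sub>0"
        "\<forall>n\<ge>1. u (n + 3) = b\<^sub>0 * u n - a\<^sub>0 * u (n + 1)"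
        "\<not> [D\<^sub>0 * u (p - 2) ^ 2 = 9 * a\<^sub>0 ^ 2] (mod int p)"
      using cases 3 by blast+
    define a b and v :: "nat \<Rightarrow> 'p mod_ring"
      where "a = (of_int a\<^sub>0 :: 'p mod_ring)" and "b = (of_int b\<^sub>0 :: 'p mod_ring)" and "v = (\<lambda>n. of_int (u n))"
    have two: "(2 :: 'p mod_ring) \<noteq> 0" and three: "(3 :: 'p mod_ring) \<noteq> 0"
      using of_nat_mod_ring_neq_0[of 2, where 'p = 'p] of_nat_mod_ring_neq_0[of 3, where 'p = 'p] p
      by (auto simp: p_def)
    have cong: "(of_int m :: 'p mod_ring) = of_int n" if "[m = n] (mod int p)" for m n
      using that of_int_mod_ring_eq_0_iff[of "m - n", where 'p = 'p]
      by (simp add: cong_iff_dvd_diff p_def)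
    have a: "3 * a = - 4" and b: "27 * b = - 38"
      using cong[OF h(1)] cong[OF h(2)] by (simp_all add: a_def b_def)
    have "a \<noteq> 0"
    proof
      assume "a = 0"
      hence "(2 :: 'p mod_ring) * 2 = 0" using a by simp
      thus False using two by (simp only: mult_eq_0_iff) simp
    qed
    have "\<not> int p dvd (- 4 * a\<^sub>0 ^ 3 - 27 * b\<^sub>0 ^ 2) * u (p - 2) ^ 2 - 9 * a\<^sub>0 ^ 2"
      using h(8) unfolding h(3) cong_iff_dvd_diff .
    hence "of_int ((- 4 * a\<^sub>0 ^ 3 - 27 * b\<^sub>0 ^ 2) * u (p - 2) ^ 2 - 9 * a\<^sub>0 ^ 2) \<noteq> (0 :: 'p mod_ring)"
      unfolding of_int_mod_ring_eq_0_iff p_def .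
    hence "(- 4 * a ^ 3 - 27 * b ^ 2) * v (CARD('p) - 2) ^ 2 \<noteq> 9 * a ^ 2"
      unfolding a_def b_def v_def p_def by simp
    moreover have "v 1 = 0" "v 2 = - a" "v 3 = b"
      unfolding v_def a_def b_def h(4,5,6) by simp_all
    moreover have "v (n + 3) = b * v n - a * v (n + 1)" if "n \<ge> 1" for n
      using h(7) that unfolding v_def a_def b_def by (metis of_int_diff of_int_mult)
    ultimately obtain y where y: "y ^ 3 + a * y = b"
      using cubic_has_root_mod_p[of a v b] p \<open>a \<noteq> 0\<close> unfolding p_def by blast
    \<comment> \<open>undoing the shift that removes the quadratic term\<close>
    define z where "z = y + 5 / 3"
    have z: "3 * z = 3 * y + 5" using three by (simp add: z_def distrib_left)
    \<comment> \<open>The factor 27 makes everything a polynomial in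
      \<open>3 * z = 3 * y + 5\<close>, free of denominators; \<open>3 * a = - 4\<close> then
      removes the linear term and \<open>27 * b = - 38\<close> the constant one.\<close>
    have "3 ^ 3 * (z ^ 3 - 5 * z ^ 2 + 7 * z - 1) = (3 * z) ^ 3 - 15 * (3 * z) ^ 2 + 63 * (3 * z) - 27"
      by Groebner_Basis.algebra
    also have "\<dots> = 27 * (y ^ 3 + a * y) - 9 * y * (3 * a + 4) + 38"
      unfolding z by Groebner_Basis.algebra
    also have "\<dots> = 0" unfolding y by (simp add: a b)
    finally have "3 ^ 3 * (z ^ 3 - 5 * z ^ 2 + 7 * z - 1) = 0" .
    moreover have "(3 :: 'p mod_ring) ^ 3 \<noteq> 0" using three by (simp only: power_eq_0_iff) simp
    ultimately have "z ^ 3 - 5 * z ^ 2 + 7 * z - 1 = 0" using mult_eq_0_iff by blast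
    moreover obtain x where "z = of_int x"
      using surj_of_nat_mod_ring[of z] by (metis of_int_of_nat_eq)
    ultimately have "(of_int (x ^ 3 - 5 * x ^ 2 + 7 * x - 1) :: 'p mod_ring) = 0" by simp
    hence "int p dvd x ^ 3 - 5 * x ^ 2 + 7 * x - 1"
      unfolding of_int_mod_ring_eq_0_iff p_def .
    with fixed_point_cubic_squarefree_mod_p[OF prime _ _ this] p 3 show ?thesis by auto
  qed
qed

section \<open>p-adic roots of the cubic\<close>

text \<open>Every deviation from the coefficients of \<open>x ^ 3 - 5 * x ^ 2 + 7 * x - 1\<close> is
  a combination of \<open>\<rho>\<close> and \<open>of_nat q\<close> with integral coefficients, so
  this polynomial is the reduction of the cubic.\<close>

lemma cubic_coeffs:
  fixes \<rho> :: "'p::prime_card padic"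
  assumes \<rho>: "padic_norm \<rho> < 1" and q: "padic_norm (of_nat q :: 'p padic) < 1"
  obtains a b c where "\<And>x. cubic q \<rho> x = x ^ 3 + (a - 5) * x ^ 2 + (b + 7) * x + (c - 1)"
    "padic_norm a < 1" "padic_norm b < 1" "padic_norm c < 1"
proof -
  let ?q = "of_nat q :: 'p padic"
  define A B where "A = \<rho> * (3 - \<rho> ^ 2) + ?q * 3"
    and "B = \<rho> * ((\<rho> - 3) ^ 2 + 3 * ?q * (\<rho> - 2)) + ?q * (9 - 3 * ?q)"
  define C where "C = ?q * (?q ^ 2 - 3 * ?q + 3)"
  have \<rho>1: "padic_norm \<rho> \<le> 1" using \<rho> by simp
  show thesis
  proof (rule that[of A "- B" C])
    show "cubic q \<rho> x = x ^ 3 + (A - 5) * x ^ 2 + (- B + 7) * x + (C - 1)" for x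
      unfolding cubic_def Let_def A_def B_def C_def by Groebner_Basis.algebra
    show "padic_norm A < 1" "padic_norm (- B) < 1" "padic_norm C < 1"
      unfolding A_def B_def C_def padic_norm_minus using \<rho> q \<rho>1
      by (intro padic_norm_add_less padic_norm_mult_less_1 padic_integral_intros; simp)+
  qed
qed

text \<open>For \<open>x\<close> of norm above 1 the leading term would strictly dominate the other
  three.\<close>

lemma padic_norm_monic_cubic_root_le_1:
  fixes x a b c :: "'p::prime_card padic"
  assumes "x ^ 3 + a * x ^ 2 + b * x + c = 0"
    and "padic_norm a \<le> 1" "padic_norm b \<le> 1" "padic_norm c \<le> 1"
  shows "padic_norm x \<le> 1"
proof (rule ccontr)
  assume "\<not> padic_norm x \<le> 1"
  hence x: "padic_norm x > 1" by simp
  hence 1: "padic_norm x \<le> padic_norm x ^ 2" "1 \<le> padic_norm x ^ 2"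
    by (simp_all add: self_le_power one_le_power)
  have "x ^ 3 = - (a * x ^ 2 + b * x + c)" using assms(1) by Groebner_Basis.algebra
  hence "padic_norm x ^ 3 = padic_norm (a * x ^ 2 + b * x + c)"
    by (metis padic_norm_minus padic_norm_power)
  also have "\<dots> \<le> padic_norm x ^ 2"
    using assms 1
    by (intro padic_norm_add_le padic_norm_mult_le_right) (auto simp: padic_norm_power)
  finally show False using x power_strict_increasing[of 2 3 "padic_norm x"] by simp
qed

lemma cubic_root_norms:
  fixes \<rho> x :: "'p::prime_card padic"
  assumes p: "CARD('p) > 3" and \<rho>: "padic_norm \<rho> < 1" and q: "padic_norm (of_nat q :: 'p padic) < 1"
    and x: "cubic q \<rho> x = 0"
  shows "padic_norm x \<le> 1" "padic_norm (x + \<rho> + of_nat q - 2) = 1" "padic_norm (x + of_nat q - 1) = 1"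
proof -
  obtain a b c where cubic: "\<And>x. cubic q \<rho> x = x ^ 3 + (a - 5) * x ^ 2 + (b + 7) * x + (c - 1)"
    and abc: "padic_norm a < 1" "padic_norm b < 1" "padic_norm c < 1"
    using cubic_coeffs[OF \<rho> q] by blast
  have "padic_norm (a - 5) \<le> 1" "padic_norm (b + 7) \<le> 1" "padic_norm (c - 1) \<le> 1"
    using abc by (intro padic_integral_intros; simp)+
  thus x1: "padic_norm x \<le> 1"
    using x unfolding cubic by (intro padic_norm_monic_cubic_root_le_1[of x "a - 5" "b + 7" "c - 1"]) auto
  define d where "d = a * x ^ 2 + b * x + c"
  have d: "padic_norm d < 1"
    unfolding d_def using abc x1
    by (intro padic_norm_add_less padic_norm_mult_less_1 padic_norm_power_le_1)
  \<comment> \<open>These are the divisions of the reduced cubic by \<open>x - 2\<close> and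
    \<open>x - 1\<close>, with its value at the root replaced by \<open>- d\<close>. If
    \<open>x - 2\<close> or \<open>x - 1\<close> had norm below 1, so would 1 or 2, and both are
    units.\<close>
  have 1: "(x - 2) * (- (x ^ 2 - 3 * x + 1)) + - d = 1" and 2: "(x - 1) * (- (x ^ 2 - 4 * x + 3)) + - d = 2"
    using x unfolding cubic d_def by Groebner_Basis.algebra+
  have x2: "padic_norm (x - 2) = 1"
  proof (rule ccontr)
    assume "padic_norm (x - 2) \<noteq> 1"
    moreover have "padic_norm (x - 2) \<le> 1" using x1 by (intro padic_integral_intros)
    ultimately have "padic_norm (x - 2) < 1" by simp
    hence "padic_norm ((x - 2) * (- (x ^ 2 - 3 * x + 1)) + - d) < 1"
      using x1 d unfolding padic_norm_minus
      by (intro padic_norm_add_less padic_norm_mult_less_1) (auto intro!: padic_integral_intros)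
    thus False unfolding 1 by simp
  qed
  have x1': "padic_norm (x - 1) = 1"
  proof (rule ccontr)
    assume "padic_norm (x - 1) \<noteq> 1"
    moreover have "padic_norm (x - 1) \<le> 1" using x1 by (intro padic_norm_diff_le) auto
    ultimately have "padic_norm (x - 1) < 1" by simp
    hence "padic_norm ((x - 1) * (- (x ^ 2 - 4 * x + 3)) + - d) < 1"
      using x1 d unfolding padic_norm_minus
      by (intro padic_norm_add_less padic_norm_mult_less_1) (auto intro!: padic_integral_intros)
    moreover have "padic_norm (2 :: 'p padic) = 1" using padic_norm_of_nat_eq_1[of 2, where 'p = 'p] p by simp
    ultimately show False unfolding 2 by simp
  qed
  have "padic_norm (\<rho> + of_nat q) < 1" using \<rho> q by (rule padic_norm_add_less)
  hence "padic_norm (x - 2 + (\<rho> + of_nat q)) = 1" "padic_norm (x - 1 + of_nat q) = 1"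
    using x2 x1' q padic_norm_add_eq_left by metis+
  thus "padic_norm (x + \<rho> + of_nat q - 2) = 1" "padic_norm (x + of_nat q - 1) = 1"
    by (simp_all add: algebra_simps)
qed

text \<open>The perturbations \<open>a\<close>, \<open>b\<close>, \<open>c\<close> of norm below 1
  affect neither the smallness of the value at \<open>n\<close> nor the unit norm of the derivative,
  so the simple root modulo p lifts.\<close>

lemma cubic_has_padic_root:
  fixes \<rho> :: "'p::prime_card padic" and n :: int
  assumes \<rho>: "padic_norm \<rho> < 1" and q: "padic_norm (of_nat q :: 'p padic) < 1"
    and n: "int CARD('p) dvd n ^ 3 - 5 * n ^ 2 + 7 * n - 1" "\<not> int CARD('p) dvd 3 * n ^ 2 - 10 * n + 7"
  shows "\<exists>x. cubic q \<rho> x = 0"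
proof -
  obtain a b c where cubic: "\<And>x. cubic q \<rho> x = x ^ 3 + (a - 5) * x ^ 2 + (b + 7) * x + (c - 1)"
    and abc: "padic_norm a < 1" "padic_norm b < 1" "padic_norm c < 1"
    using cubic_coeffs[OF \<rho> q] by blast
  define x where "x = (of_int n :: 'p padic)"
  have x1: "padic_norm x \<le> 1" unfolding x_def by (rule padic_norm_of_int_le_1)
  have "padic_norm (of_int (n ^ 3 - 5 * n ^ 2 + 7 * n - 1) :: 'p padic) \<le> 1 / real CARD('p)"
    by (rule padic_norm_of_int_le) (rule n)
  also have "\<dots> < 1" using prime_gt_1_nat[OF prime_card[where 'a = 'p]] by simp
  finally have "padic_norm (x ^ 3 - 5 * x ^ 2 + 7 * x - 1) < 1" by (simp add: x_def)
  moreover have "padic_norm (a * x ^ 2 + b * x + c) < 1"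
    using abc x1 by (intro padic_norm_add_less padic_norm_mult_less_1 padic_norm_power_le_1)
  ultimately have "padic_norm (x ^ 3 - 5 * x ^ 2 + 7 * x - 1 + (a * x ^ 2 + b * x + c)) < 1"
    by (rule padic_norm_add_less)
  also have "x ^ 3 - 5 * x ^ 2 + 7 * x - 1 + (a * x ^ 2 + b * x + c) =
      x ^ 3 + (a - 5) * x ^ 2 + (b + 7) * x + (c - 1)"
    by Groebner_Basis.algebra
  finally have g: "padic_norm (x ^ 3 + (a - 5) * x ^ 2 + (b + 7) * x + (c - 1)) < 1" .
  have "padic_norm (of_int (3 * n ^ 2 - 10 * n + 7) :: 'p padic) = 1"
    by (rule padic_norm_of_int_eq_1) (rule n)
  hence "padic_norm (3 * x ^ 2 - 10 * x + 7) = 1" by (simp add: x_def)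
  moreover have "padic_norm (a * (2 * x) + b) < 1"
    using abc x1 by (intro padic_norm_add_less padic_norm_mult_less_1 padic_integral_intros)
  ultimately have "padic_norm (3 * x ^ 2 - 10 * x + 7 + (a * (2 * x) + b)) = 1"
    by (metis padic_norm_add_eq_left)
  also have "3 * x ^ 2 - 10 * x + 7 + (a * (2 * x) + b) = 3 * x ^ 2 + 2 * (a - 5) * x + (b + 7)"
    by Groebner_Basis.algebra
  finally have g': "padic_norm (3 * x ^ 2 + 2 * (a - 5) * x + (b + 7)) = 1" .
  have "padic_norm (a - 5) \<le> 1"
    using abc by (intro padic_integral_intros) simp
  from padic_hensel_cubic[OF this x1 g g'] show ?thesis unfolding cubic by blast
qed

lemma fixed_point_equation_cubic:
  assumes x: "cubic q \<rho> x = 0" and nz: "x + \<rho> + of_nat q - 2 \<noteq> 0"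
  shows "fixed_point_equation q \<rho> x"
proof -
  have "x * (x + \<rho> + of_nat q - 2) ^ 3 - (\<rho> * x + of_nat q - 1) ^ 3 = (x - 1) * cubic q \<rho> x"
    unfolding cubic_def Let_def by Groebner_Basis.algebra
  hence "x * (x + \<rho> + of_nat q - 2) ^ 3 = (\<rho> * x + of_nat q - 1) ^ 3" using x by simp
  thus ?thesis using nz by (simp add: fixed_point_equation_def power_divide nonzero_eq_divide_eq)
qed

lemma fixed_point_equation_1:
  "1 + \<rho> + of_nat q - 2 \<noteq> 0 \<Longrightarrow> fixed_point_equation q \<rho> 1"
  by (simp add: fixed_point_equation_def)

section \<open>Compatibility on the invariant line\<close>

lemma finite_tree_W [simp, intro]: "finite (tree_W n)"
  using finite_lists_length_eq[of "UNIV :: 3 set" n] by (simp add: tree_W_def)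

lemma finite_tree_V [simp, intro]: "finite (tree_V n)"
  by (simp add: tree_V_def)

lemma tree_V_Suc: "tree_V (Suc n) = tree_V n \<union> tree_W (Suc n)"
  by (auto simp: tree_V_def atMost_Suc)

lemma tree_V_Int_tree_W_Suc: "tree_V n \<inter> tree_W (Suc n) = {}"
  by (auto simp: tree_V_def tree_W_def)

lemma tree_W_Suc: "tree_W (Suc n) = (\<lambda>(x, i). i # x) ` (tree_W n \<times> UNIV)"
  by (auto simp: tree_W_def length_Suc_conv image_iff)

lemma tree_L_Suc: "tree_L (Suc n) = tree_L n \<union> (\<lambda>(x, i). (x, i # x)) ` (tree_W n \<times> UNIV)"
proof -
  have "x \<in> tree_V n \<longleftrightarrow> length x \<le> n" for x n
    by (auto simp: tree_V_def tree_W_def)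
  thus ?thesis by (auto simp: tree_L_def tree_W_def image_iff)
qed

lemma finite_tree_L [simp, intro]: "finite (tree_L n)"
  by (rule finite_subset[of _ "tree_V n \<times> tree_V n"]) (auto simp: tree_L_def)

lemma prod_tree_W_Suc: "prod f (tree_W (Suc n)) = (\<Prod>x\<in>tree_W n. \<Prod>i\<in>UNIV. f (i # x))"
  unfolding tree_W_Suc
  by (subst prod.reindex) (auto simp: inj_on_def prod.cartesian_product case_prod_unfold)

lemma hamiltonian_Suc:
  "hamiltonian (Suc n) \<sigma> = hamiltonian n \<sigma> + (\<Sum>x\<in>tree_W n. \<Sum>i\<in>UNIV. of_bool (\<sigma> x = \<sigma> (i # x)))"
proof -
  have "tree_L n \<inter> (\<lambda>(x, i). (x, i # x)) ` (tree_W n \<times> UNIV) = {}"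
    by (auto simp: tree_L_def tree_V_def tree_W_def)
  hence "hamiltonian (Suc n) \<sigma> = hamiltonian n \<sigma> +
      (\<Sum>(x, y)\<in>(\<lambda>(x, i). (x, i # x)) ` (tree_W n \<times> UNIV). of_bool (\<sigma> x = \<sigma> y))"
    unfolding hamiltonian_def tree_L_Suc by (intro sum.union_disjoint) auto
  also have "(\<Sum>(x, y)\<in>(\<lambda>(x, i). (x, i # x)) ` (tree_W n \<times> UNIV). of_bool (\<sigma> x = \<sigma> y)) =
      (\<Sum>x\<in>tree_W n. \<Sum>i\<in>UNIV. of_bool (\<sigma> x = \<sigma> (i # x)))"
    by (subst sum.reindex) (auto simp: inj_on_def sum.cartesian_product case_prod_unfold)
  finally show ?thesis .
qed

section \<open>Splitting off and summing out the last generation\<close>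

lemma finite_configs_on [simp, intro]: "finite U \<Longrightarrow> finite (configs_on q U)"
  unfolding configs_on_def by (intro finite_PiE) auto

lemma concat_config_in_configs_on:
  assumes "\<sigma> \<in> configs_on q (tree_V n)" "\<omega> \<in> configs_on q (tree_W (Suc n))"
  shows "concat_config (Suc n) \<sigma> \<omega> \<in> configs_on q (tree_V (Suc n))"
  using assms unfolding configs_on_def concat_config_def tree_V_Suc by (auto simp: PiE_iff extensional_def)

lemma restrict_concat_config:
  assumes "\<sigma> \<in> configs_on q (tree_V n)"
  shows "restrict (concat_config (Suc n) \<sigma> \<omega>) (tree_V n) = \<sigma>"
proof
  fix x
  show "restrict (concat_config (Suc n) \<sigma> \<omega>) (tree_V n) x = \<sigma> x"
  proof (cases "x \<in> tree_V n")
    case True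
    hence "x \<notin> tree_W (Suc n)" using tree_V_Int_tree_W_Suc[of n] by blast
    thus ?thesis using True by (simp add: concat_config_def)
  next
    case False
    \<comment> \<open>Off the ball both functions take the default value, so they agree on the whole
      tree.\<close>
    hence "\<sigma> x = undefined" using assms unfolding configs_on_def by (rule PiE_arb[rotated])
    thus ?thesis using False by simp
  qed
qed

lemma sum_configs_on_Suc:
  "(\<Sum>\<tau>\<in>configs_on q (tree_V (Suc n)). F \<tau>) =
     (\<Sum>\<sigma>\<in>configs_on q (tree_V n). \<Sum>\<omega>\<in>configs_on q (tree_W (Suc n)). F (concat_config (Suc n) \<sigma> \<omega>))"
proof -
  have "(\<Sum>(\<sigma>, \<omega>)\<in>configs_on q (tree_V n) \<times> configs_on q (tree_W (Suc n)). F (concat_config (Suc n) \<sigma> \<omega>)) =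
      (\<Sum>\<tau>\<in>configs_on q (tree_V (Suc n)). F \<tau>)"
  proof (rule sum.reindex_bij_witness[where j = "\<lambda>(\<sigma>, \<omega>). concat_config (Suc n) \<sigma> \<omega>"
        and i = "\<lambda>\<tau>. (restrict \<tau> (tree_V n), restrict \<tau> (tree_W (Suc n)))"])
    fix \<tau> assume "\<tau> \<in> configs_on q (tree_V (Suc n))"
    thus "(case (restrict \<tau> (tree_V n), restrict \<tau> (tree_W (Suc n))) of
        (\<sigma>, \<omega>) \<Rightarrow> concat_config (Suc n) \<sigma> \<omega>) = \<tau>"
      by (auto simp: concat_config_def configs_on_def tree_V_Suc PiE_iff extensional_def fun_eq_iff)
    show "(restrict \<tau> (tree_V n), restrict \<tau> (tree_W (Suc n))) \<in>
        configs_on q (tree_V n) \<times> configs_on q (tree_W (Suc n))"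
      using \<open>\<tau> \<in> _\<close> by (auto simp: configs_on_def tree_V_Suc)
  next
    fix c assume "c \<in> configs_on q (tree_V n) \<times> configs_on q (tree_W (Suc n))"
    then obtain \<sigma> \<omega> where c: "c = (\<sigma>, \<omega>)" "\<sigma> \<in> configs_on q (tree_V n)" "\<omega> \<in> configs_on q (tree_W (Suc n))"
      by blast
    have "restrict (concat_config (Suc n) \<sigma> \<omega>) (tree_W (Suc n)) = \<omega>"
      using c(3) by (auto simp: concat_config_def configs_on_def PiE_iff extensional_def fun_eq_iff)
    thus "(restrict (case c of (\<sigma>, \<omega>) \<Rightarrow> concat_config (Suc n) \<sigma> \<omega>) (tree_V n),
        restrict (case c of (\<sigma>, \<omega>) \<Rightarrow> concat_config (Suc n) \<sigma> \<omega>) (tree_W (Suc n))) = c"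
      using restrict_concat_config[OF c(2)] c(1) by simp
    show "(case c of (\<sigma>, \<omega>) \<Rightarrow> concat_config (Suc n) \<sigma> \<omega>) \<in> configs_on q (tree_V (Suc n))"
      using concat_config_in_configs_on c by simp
  qed auto
  thus ?thesis by (simp add: sum.cartesian_product)
qed

text \<open>Each vertex \<open>y\<close> of the last generation lies on exactly one new edge, the
  one to its parent \<open>tl y\<close>. Hence the new part of the weight is a product over single
  vertices.\<close>

lemma potts_weight_concat_config:
  "potts_weight \<rho> h (Suc n) (concat_config (Suc n) \<sigma> \<omega>) =
     \<rho> ^ hamiltonian n \<sigma> * (\<Prod>y\<in>tree_W (Suc n). \<rho> ^ of_bool (\<sigma> (tl y) = \<omega> y) * h y (\<omega> y))"
proof -
  let ?\<tau> = "concat_config (Suc n) \<sigma> \<omega>"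
  have \<tau>: "?\<tau> x = \<sigma> x" if "x \<in> tree_V n" for x
    using that tree_V_Int_tree_W_Suc[of n] by (auto simp: concat_config_def)
  have WV: "tree_W n \<subseteq> tree_V n" by (auto simp: tree_V_def)
  have "hamiltonian n ?\<tau> = hamiltonian n \<sigma>"
    unfolding hamiltonian_def by (intro sum.cong) (auto simp: tree_L_def \<tau>)
  moreover have "(\<Sum>x\<in>tree_W n. \<Sum>i\<in>UNIV. of_bool (?\<tau> x = ?\<tau> (i # x))) =
      (\<Sum>x\<in>tree_W n. \<Sum>i\<in>UNIV. (of_bool (\<sigma> x = \<omega> (i # x)) :: nat))"
    using WV by (intro sum.cong) (auto simp: \<tau> concat_config_def tree_W_def subset_iff)
  moreover have "(\<Prod>y\<in>tree_W (Suc n). h y (?\<tau> y)) = (\<Prod>y\<in>tree_W (Suc n). h y (\<omega> y))"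
    by (intro prod.cong) (auto simp: concat_config_def)
  ultimately have "potts_weight \<rho> h (Suc n) ?\<tau> = \<rho> ^ hamiltonian n \<sigma> *
      (\<rho> ^ (\<Sum>x\<in>tree_W n. \<Sum>i\<in>UNIV. of_bool (\<sigma> x = \<omega> (i # x))) * (\<Prod>y\<in>tree_W (Suc n). h y (\<omega> y)))"
    unfolding potts_weight_def hamiltonian_Suc by (simp only: power_add mult.assoc)
  thus ?thesis
    by (simp only: power_sum prod.distrib prod_tree_W_Suc list.sel)
qed

text \<open>By distributivity the sum over all \<open>\<omega>\<close> of the vertexwise product is
  a product of sums over one spin \<open>j\<close>; the factors are then grouped by parent.\<close>

lemma sum_potts_weight_concat_config:
  "(\<Sum>\<omega>\<in>configs_on q (tree_W (Suc n)). potts_weight \<rho> h (Suc n) (concat_config (Suc n) \<sigma> \<omega>)) =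
     \<rho> ^ hamiltonian n \<sigma> *
     (\<Prod>x\<in>tree_W n. \<Prod>i\<in>UNIV. \<Sum>j<q. \<rho> ^ of_bool (\<sigma> x = j) * h (i # x) j)"
proof -
  have "(\<Sum>\<omega>\<in>configs_on q (tree_W (Suc n)). potts_weight \<rho> h (Suc n) (concat_config (Suc n) \<sigma> \<omega>)) =
      \<rho> ^ hamiltonian n \<sigma> *
      (\<Prod>y\<in>tree_W (Suc n). \<Sum>j<q. \<rho> ^ of_bool (\<sigma> (tl y) = j) * h y j)"
    unfolding potts_weight_concat_config sum_distrib_left[symmetric] configs_on_def
    by (subst prod_sum_PiE) auto
  thus ?thesis by (simp only: prod_tree_W_Suc list.sel)
qed

section \<open>The recursion on the invariant line\<close>

lemma sum_invariant_line:
  fixes \<rho> k :: "'p::prime_card padic"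
  assumes "s < q" "i\<^sub>0 < q"
  shows "(\<Sum>j<q. \<rho> ^ of_bool (s = j) * invariant_line i\<^sub>0 k x j) =
     (if s = i\<^sub>0 then \<rho> * k + of_nat q - 1 else k + \<rho> + of_nat q - 2)"
proof -
  have "(\<Sum>j<q. \<rho> ^ of_bool (s = j) * invariant_line i\<^sub>0 k x j) =
      (\<Sum>j<q. 1 + (if j = s then (\<rho> - 1) * invariant_line i\<^sub>0 k x s else 0) + (if j = i\<^sub>0 then k - 1 else 0))"
    by (intro sum.cong) (auto simp: invariant_line_def algebra_simps)
  also have "\<dots> = of_nat q + (\<rho> - 1) * invariant_line i\<^sub>0 k x s + (k - 1)"
    using assms by (simp add: sum.distrib)
  also have "\<dots> = (if s = i\<^sub>0 then \<rho> * k + of_nat q - 1 else k + \<rho> + of_nat q - 2)"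
    by (simp add: invariant_line_def algebra_simps)
  finally show ?thesis .
qed

text \<open>The three successors of a vertex contribute the cube of one spin sum. The fixed point
  equation says that the cube at spin \<open>i\<^sub>0\<close> is \<open>k\<close> times the cube at
  any other spin, so a common constant factors out and the old boundary weight remains.\<close>

lemma sum_potts_weight_invariant_line:
  fixes \<rho> k :: "'p::prime_card padic"
  assumes fp: "fixed_point_equation q \<rho> k" and i0: "i\<^sub>0 < q" and \<sigma>: "\<sigma> \<in> configs_on q (tree_V n)"
  shows "(\<Sum>\<omega>\<in>configs_on q (tree_W (Suc n)).
       potts_weight \<rho> (invariant_line i\<^sub>0 k) (Suc n) (concat_config (Suc n) \<sigma> \<omega>)) =
     ((k + \<rho> + of_nat q - 2) ^ 3) ^ card (tree_W n) * potts_weight \<rho> (invariant_line i\<^sub>0 k) n \<sigma>"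
proof -
  define a where "a = k + \<rho> + of_nat q - 2"
  have a0: "a \<noteq> 0" and k: "k = ((\<rho> * k + of_nat q - 1) / a) ^ 3"
    using fp by (auto simp: fixed_point_equation_def a_def)
  have ka: "(\<rho> * k + of_nat q - 1) ^ 3 = a ^ 3 * k"
    using a0 k by (simp add: power_divide field_simps)
  have "(\<Prod>i\<in>(UNIV :: 3 set). \<Sum>j<q. \<rho> ^ of_bool (\<sigma> x = j) * invariant_line i\<^sub>0 k (i # x) j) =
      a ^ 3 * invariant_line i\<^sub>0 k x (\<sigma> x)" if "x \<in> tree_W n" for x
  proof -
    have "\<sigma> x < q" using \<sigma> that by (auto simp: configs_on_def tree_V_def)
    thus ?thesis
      unfolding sum_invariant_line[OF \<open>\<sigma> x < q\<close> i0] using ka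
      by (auto simp: invariant_line_def a_def)
  qed
  thus ?thesis
    unfolding sum_potts_weight_concat_config
    by (simp add: potts_weight_def prod.distrib a_def)
qed

lemma potts_Z_Suc_invariant_line:
  assumes "fixed_point_equation q \<rho> k" "i\<^sub>0 < q"
  shows "potts_Z q \<rho> (invariant_line i\<^sub>0 k) (Suc n) =
     ((k + \<rho> + of_nat q - 2) ^ 3) ^ card (tree_W n) * potts_Z q \<rho> (invariant_line i\<^sub>0 k) n"
  unfolding potts_Z_def sum_configs_on_Suc sum_distrib_left
  by (intro sum.cong refl sum_potts_weight_invariant_line assms)

text \<open>Starting the recursion at the root level needs only a sum over one spin, whereas level 1
  already involves four vertices.\<close>

lemma potts_Z_0_invariant_line:
  fixes k :: "'p::prime_card padic"
  assumes "i\<^sub>0 < q"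
  shows "potts_Z q \<rho> (invariant_line i\<^sub>0 k) 0 = k + of_nat q - 1"
proof -
  have V: "tree_V 0 = {root}" and W: "tree_W 0 = {root}" and L: "tree_L 0 = {}"
    by (auto simp: tree_V_def tree_W_def tree_L_def)
  have "potts_Z q \<rho> (invariant_line i\<^sub>0 k) 0 =
      (\<Sum>\<sigma>\<in>{root} \<rightarrow>\<^sub>E {..<q}. \<Prod>x\<in>{root}. invariant_line i\<^sub>0 k x (\<sigma> x))"
    by (simp add: potts_Z_def potts_weight_def hamiltonian_def configs_on_def V W L)
  also have "\<dots> = (\<Sum>j<q. invariant_line i\<^sub>0 k root j)"
    by (subst prod_sum_PiE[symmetric]) auto
  also have "\<dots> = (\<Sum>j<q. 1 + (if j = i\<^sub>0 then k - 1 else 0))"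
    by (intro sum.cong) (auto simp: invariant_line_def)
  also have "\<dots> = k + of_nat q - 1" using assms by (simp add: sum.distrib)
  finally show ?thesis .
qed

text \<open>Summing out a generation multiplies the weight and the normalizing factor by the same
  nonzero constant, which cancels in the quotient.\<close>

lemma compatible_invariant_line:
  assumes fp: "fixed_point_equation q \<rho> k" and i0: "i\<^sub>0 < q" and Z0: "k + of_nat q - 1 \<noteq> 0"
  shows "compatible q \<rho> (invariant_line i\<^sub>0 k)"
proof -
  have Z: "potts_Z q \<rho> (invariant_line i\<^sub>0 k) n \<noteq> 0" for n
  proof (induction n)
    case 0
    thus ?case using Z0 i0 by (simp add: potts_Z_0_invariant_line)
  next
    case (Suc n)
    thus ?case using fp i0 by (simp add: potts_Z_Suc_invariant_line fixed_point_equation_def)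
  qed
  have "(\<Sum>\<omega>\<in>configs_on q (tree_W (Suc n)). potts_mu q \<rho> (invariant_line i\<^sub>0 k) (Suc n)
       (concat_config (Suc n) \<sigma> \<omega>)) = potts_mu q \<rho> (invariant_line i\<^sub>0 k) n \<sigma>"
    if "\<sigma> \<in> configs_on q (tree_V n)" for n \<sigma>
    using fp Z[of n]
    unfolding potts_mu_def sum_distrib_left[symmetric] sum_potts_weight_invariant_line[OF fp i0 that]
      potts_Z_Suc_invariant_line[OF fp i0]
    by (simp add: fixed_point_equation_def)
  moreover have "\<exists>m. n = Suc m" if "n \<ge> 2" for n
    using that by (cases n) auto
  ultimately show ?thesis using Z unfolding compatible_def by fastforce
qed

section \<open>Existence and boundedness of the measures\<close>

definition cylinders_at :: "nat \<Rightarrow> nat \<Rightarrow> (vertex \<Rightarrow> nat) set set" where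
  "cylinders_at q n = cylinder q n ` Pow (configs_on q (tree_V n))"

lemma cylinders_eq_UN: "cylinders q = (\<Union>n. cylinders_at q n)"
  by (auto simp: cylinders_def cylinders_at_def)

text \<open>Every configuration on the ball extends to the tree by the spin 0, so a cylinder
  determines its base at a given level.\<close>

lemma restrict_image_cylinder:
  assumes q: "q > 0" and E: "E \<subseteq> configs_on q (tree_V n)"
  shows "(\<lambda>\<sigma>. restrict \<sigma> (tree_V n)) ` cylinder q n E = E"
proof (intro equalityI subsetI)
  fix \<tau> assume \<tau>: "\<tau> \<in> E"
  define \<sigma> where "\<sigma> x = (if x \<in> tree_V n then \<tau> x else 0)" for x
  have \<tau>': "\<tau> \<in> tree_V n \<rightarrow>\<^sub>E {..<q}" using \<tau> E by (auto simp: configs_on_def)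
  have "restrict \<sigma> (tree_V n) = \<tau>"
  proof
    fix x show "restrict \<sigma> (tree_V n) x = \<tau> x"
      using PiE_arb[OF \<tau>', of x] by (simp add: \<sigma>_def)
  qed
  moreover have "\<sigma> \<in> configs q" using \<tau>' q by (auto simp: configs_def \<sigma>_def)
  ultimately show "\<tau> \<in> (\<lambda>\<sigma>. restrict \<sigma> (tree_V n)) ` cylinder q n E"
    using \<tau> by (auto simp: cylinder_def image_iff intro!: exI[of _ \<sigma>])
qed (auto simp: cylinder_def)

lemma restrict_in_configs_on: "\<sigma> \<in> configs q \<Longrightarrow> restrict \<sigma> U \<in> configs_on q U"
  by (auto simp: configs_def configs_on_def)

lemma cylinder_Suc:
  "cylinder q n E = cylinder q (Suc n) {\<tau> \<in> configs_on q (tree_V (Suc n)). restrict \<tau> (tree_V n) \<in> E}"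
proof -
  have "tree_V (Suc n) \<inter> tree_V n = tree_V n" by (auto simp: tree_V_Suc)
  thus ?thesis by (auto simp: cylinder_def restrict_in_configs_on)
qed

lemma cylinder_Int: "cylinder q n E \<inter> cylinder q n F = cylinder q n (E \<inter> F)"
  by (auto simp: cylinder_def)

lemma cylinder_Un: "cylinder q n E \<union> cylinder q n F = cylinder q n (E \<union> F)"
  by (auto simp: cylinder_def)

lemma cylinder_Compl: "configs q - cylinder q n E = cylinder q n (configs_on q (tree_V n) - E)"
  by (auto simp: cylinder_def restrict_in_configs_on)

lemma cylinder_configs_on: "cylinder q n (configs_on q (tree_V n)) = configs q"
  by (auto simp: cylinder_def restrict_in_configs_on)

lemma cylinders_at_mono: "m \<le> n \<Longrightarrow> cylinders_at q m \<subseteq> cylinders_at q n"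
proof (rule lift_Suc_mono_le[of "cylinders_at q"])
  fix n show "cylinders_at q n \<subseteq> cylinders_at q (Suc n)"
  proof
    fix A assume "A \<in> cylinders_at q n"
    then obtain E where "A = cylinder q n E" by (auto simp: cylinders_at_def)
    thus "A \<in> cylinders_at q (Suc n)"
      unfolding cylinders_at_def by (subst (asm) cylinder_Suc) auto
  qed
qed

text \<open>Lifting both sets to one level reduces Boolean operations and additivity to operations
  on bases.\<close>

lemma cylinders_common_level:
  assumes "A \<in> cylinders q" "B \<in> cylinders q"
  obtains n E F where "n \<ge> 1" "E \<subseteq> configs_on q (tree_V n)" "F \<subseteq> configs_on q (tree_V n)"
    "A = cylinder q n E" "B = cylinder q n F"
proof -
  obtain i j where "A \<in> cylinders_at q i" "B \<in> cylinders_at q j"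
    using assms unfolding cylinders_eq_UN by blast
  \<comment> \<open>The successor keeps the level at least 1, where the finite-volume densities are
    prescribed.\<close>
  moreover have "cylinders_at q i \<subseteq> cylinders_at q (Suc (max i j))"
    "cylinders_at q j \<subseteq> cylinders_at q (Suc (max i j))"
    by (intro cylinders_at_mono; simp)+
  ultimately have "A \<in> cylinders_at q (Suc (max i j))" "B \<in> cylinders_at q (Suc (max i j))"
    by blast+
  then obtain E F where "E \<subseteq> configs_on q (tree_V (Suc (max i j)))" "A = cylinder q (Suc (max i j)) E"
    "F \<subseteq> configs_on q (tree_V (Suc (max i j)))" "B = cylinder q (Suc (max i j)) F"
    unfolding cylinders_at_def by blast
  thus thesis by (intro that[of "Suc (max i j)" E F]) simp_all
qed

lemma cylinders_level:
  assumes "A \<in> cylinders q"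
  obtains n E where "n \<ge> 1" "E \<subseteq> configs_on q (tree_V n)" "A = cylinder q n E"
  by (rule cylinders_common_level[OF assms assms]) (rule that)

lemma cylinder_in_cylinders: "E \<subseteq> configs_on q (tree_V n) \<Longrightarrow> cylinder q n E \<in> cylinders q"
  by (auto simp: cylinders_def)

lemma algebra_cylinders: "Sigma_Algebra.algebra (configs q) (cylinders q)"
proof (unfold algebra_iff_Un, intro conjI ballI)
  show "cylinders q \<subseteq> Pow (configs q)"
    by (auto simp: cylinders_def cylinder_def)
  show "{} \<in> cylinders q"
    using cylinder_in_cylinders[of "{}" q 0] by (simp add: cylinder_def)
  fix A B assume A: "A \<in> cylinders q" and B: "B \<in> cylinders q"
  obtain n E F where "E \<subseteq> configs_on q (tree_V n)" "F \<subseteq> configs_on q (tree_V n)"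
    "A = cylinder q n E" "B = cylinder q n F"
    by (rule cylinders_common_level[OF A B])
  thus "A \<union> B \<in> cylinders q" by (simp add: cylinder_Un cylinder_in_cylinders)
next
  fix A assume "A \<in> cylinders q"
  then obtain n E where "E \<subseteq> configs_on q (tree_V n)" "A = cylinder q n E"
    by (rule cylinders_level)
  thus "configs q - A \<in> cylinders q"
    by (simp add: cylinder_Compl cylinder_in_cylinders)
qed

text \<open>The base is recovered from \<open>A\<close> by restriction, so that the value depends on
  the set and the level, not on a chosen presentation as a cylinder.\<close>

definition cylinder_sum ::
  "nat \<Rightarrow> 'p::prime_card padic \<Rightarrow> (vertex \<Rightarrow> nat \<Rightarrow> 'p padic) \<Rightarrow> nat \<Rightarrow> (vertex \<Rightarrow> nat) set \<Rightarrow> 'p padic" where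
  "cylinder_sum q \<rho> h n A = (\<Sum>\<tau>\<in>(\<lambda>\<sigma>. restrict \<sigma> (tree_V n)) ` A. potts_mu q \<rho> h n \<tau>)"

lemma cylinder_sum_cylinder:
  "q > 0 \<Longrightarrow> E \<subseteq> configs_on q (tree_V n) \<Longrightarrow>
     cylinder_sum q \<rho> h n (cylinder q n E) = (\<Sum>\<tau>\<in>E. potts_mu q \<rho> h n \<tau>)"
  by (simp add: cylinder_sum_def restrict_image_cylinder)

text \<open>Whether a configuration on the larger ball belongs to the lifted base depends only on
  its inner part; compatibility then sums out the outer part.\<close>

lemma cylinder_sum_Suc:
  assumes q: "q > 0" and comp: "compatible q \<rho> h" and n: "n \<ge> 1" and A: "A \<in> cylinders_at q n"
  shows "cylinder_sum q \<rho> h (Suc n) A = cylinder_sum q \<rho> h n A"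
proof -
  obtain E where E: "E \<subseteq> configs_on q (tree_V n)" "A = cylinder q n E"
    using A by (auto simp: cylinders_at_def)
  let ?C = "configs_on q (tree_V (Suc n))"
  have "cylinder_sum q \<rho> h (Suc n) A = (\<Sum>\<tau>\<in>{\<tau> \<in> ?C. restrict \<tau> (tree_V n) \<in> E}. potts_mu q \<rho> h (Suc n) \<tau>)"
    unfolding E(2) cylinder_Suc[of q n E] by (rule cylinder_sum_cylinder[OF q]) auto
  also have "\<dots> = (\<Sum>\<tau>\<in>?C. if restrict \<tau> (tree_V n) \<in> E then potts_mu q \<rho> h (Suc n) \<tau> else 0)"
    by (rule sum.inter_filter) auto
  also have "\<dots> = (\<Sum>\<sigma>\<in>configs_on q (tree_V n). if \<sigma> \<in> E then potts_mu q \<rho> h n \<sigma> else 0)"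
    unfolding sum_configs_on_Suc
  proof (rule sum.cong)
    fix \<sigma> assume \<sigma>: "\<sigma> \<in> configs_on q (tree_V n)"
    have "(\<Sum>\<omega>\<in>configs_on q (tree_W (Suc n)). potts_mu q \<rho> h (Suc n) (concat_config (Suc n) \<sigma> \<omega>)) =
        potts_mu q \<rho> h n \<sigma>"
      using comp n \<sigma> unfolding compatible_def by (auto dest!: spec[of _ "Suc n"])
    thus "(\<Sum>\<omega>\<in>configs_on q (tree_W (Suc n)).
        if restrict (concat_config (Suc n) \<sigma> \<omega>) (tree_V n) \<in> E
        then potts_mu q \<rho> h (Suc n) (concat_config (Suc n) \<sigma> \<omega>) else 0) =
        (if \<sigma> \<in> E then potts_mu q \<rho> h n \<sigma> else 0)"
      unfolding restrict_concat_config[OF \<sigma>] by simp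
  qed simp
  also have "\<dots> = (\<Sum>\<sigma>\<in>{\<sigma> \<in> configs_on q (tree_V n). \<sigma> \<in> E}. potts_mu q \<rho> h n \<sigma>)"
    by (rule sum.inter_filter[symmetric]) auto
  also have "{\<sigma> \<in> configs_on q (tree_V n). \<sigma> \<in> E} = E" using E(1) by blast
  also have "(\<Sum>\<sigma>\<in>E. potts_mu q \<rho> h n \<sigma>) = cylinder_sum q \<rho> h n A"
    unfolding E(2) by (rule cylinder_sum_cylinder[OF q E(1), symmetric])
  finally show ?thesis .
qed

lemma cylinder_sum_level_indep:
  assumes "q > 0" "compatible q \<rho> h" "m \<ge> 1" "A \<in> cylinders_at q m" "n \<ge> m"
  shows "cylinder_sum q \<rho> h n A = cylinder_sum q \<rho> h m A"
  using assms(5)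
proof (induction n rule: dec_induct)
  case (step n)
  have "A \<in> cylinders_at q n" using cylinders_at_mono[OF step(1)] assms(4) by blast
  thus ?case using cylinder_sum_Suc[OF assms(1,2), of n A] step assms(3) by simp
qed simp

text \<open>Any admissible level may be picked: for compatible densities the value does not depend
  on it, by \<open>cylinder_sum_level_indep\<close>.\<close>

definition cylinder_measure ::
  "nat \<Rightarrow> 'p::prime_card padic \<Rightarrow> (vertex \<Rightarrow> nat \<Rightarrow> 'p padic) \<Rightarrow> (vertex \<Rightarrow> nat) set \<Rightarrow> 'p padic" where
  "cylinder_measure q \<rho> h A = cylinder_sum q \<rho> h (SOME n. n \<ge> 1 \<and> A \<in> cylinders_at q n) A"

lemma cylinder_measure_cylinder:
  assumes q: "q > 0" and comp: "compatible q \<rho> h" and n: "n \<ge> 1" and E: "E \<subseteq> configs_on q (tree_V n)"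
  shows "cylinder_measure q \<rho> h (cylinder q n E) = (\<Sum>\<tau>\<in>E. potts_mu q \<rho> h n \<tau>)"
proof -
  let ?A = "cylinder q n E"
  define m where "m = (SOME n. n \<ge> 1 \<and> ?A \<in> cylinders_at q n)"
  have A: "?A \<in> cylinders_at q n" using E by (auto simp: cylinders_at_def)
  with n have m: "m \<ge> 1 \<and> ?A \<in> cylinders_at q m"
    unfolding m_def by (intro someI[of "\<lambda>n. n \<ge> 1 \<and> ?A \<in> cylinders_at q n"] conjI)
  have "cylinder_sum q \<rho> h m ?A = cylinder_sum q \<rho> h n ?A"
    using cylinder_sum_level_indep[OF q comp, of m ?A n] cylinder_sum_level_indep[OF q comp n A, of m] m
    by (cases "m \<le> n") auto
  thus ?thesis
    unfolding cylinder_measure_def m_def[symmetric] using cylinder_sum_cylinder[OF q E] by simp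
qed

text \<open>Only finite additivity is required, so no limit is involved: disjoint cylinders have
  disjoint bases at a common level, and the total mass is the normalized sum at level 1.\<close>

lemma quasi_gibbs_measure_cylinder_measure:
  assumes q: "q > 0" and comp: "compatible q \<rho> h" and h0: "\<And>x. x \<noteq> root \<Longrightarrow> h x 0 = 1"
  shows "quasi_gibbs_measure q \<rho> h (cylinder_measure q \<rho> h)"
proof -
  note val = cylinder_measure_cylinder[OF q comp]
  have "cylinder_measure q \<rho> h (A \<union> B) = cylinder_measure q \<rho> h A + cylinder_measure q \<rho> h B"
    if A: "A \<in> cylinders q" and B: "B \<in> cylinders q" and disj: "A \<inter> B = {}" for A B
  proof -
    obtain n E F where n: "n \<ge> 1" and E: "E \<subseteq> configs_on q (tree_V n)" and F: "F \<subseteq> configs_on q (tree_V n)"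
      and AB: "A = cylinder q n E" "B = cylinder q n F"
      by (rule cylinders_common_level[OF A B])
    have "cylinder q n (E \<inter> F) = {}" using disj unfolding AB cylinder_Int .
    hence "E \<inter> F = {}" using restrict_image_cylinder[OF q, of "E \<inter> F" n] E by auto
    moreover have "finite E" "finite F" using E F by (auto intro: finite_subset)
    ultimately show ?thesis
      unfolding AB cylinder_Un using E F by (simp add: val[OF n] sum.union_disjoint)
  qed
  moreover have "cylinder_measure q \<rho> h (configs q) = 1"
  proof -
    have "cylinder_measure q \<rho> h (configs q) = (\<Sum>\<tau>\<in>configs_on q (tree_V 1). potts_mu q \<rho> h 1 \<tau>)"
      unfolding cylinder_configs_on[of q 1, symmetric] by (rule val) auto
    also have "\<dots> = 1 / potts_Z q \<rho> h 1 * potts_Z q \<rho> h 1"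
      unfolding potts_mu_def sum_distrib_left[symmetric] potts_Z_def ..
    also have "\<dots> = 1" using comp by (simp add: compatible_def)
    finally show ?thesis .
  qed
  moreover have "cylinder_measure q \<rho> h (cylinder q n {\<sigma>}) = potts_mu q \<rho> h n \<sigma>"
    if "n \<ge> 1" "\<sigma> \<in> configs_on q (tree_V n)" for n \<sigma>
    using val[of n "{\<sigma>}"] that by simp
  ultimately show ?thesis
    using h0 comp algebra_cylinders
    unfolding quasi_gibbs_measure_def padic_prob_measure_def padic_measure_def by blast
qed

text \<open>Finite additivity fixes the measure on all cylinders. Boundedness can therefore be shown
  for every measure with the given densities, not just for the constructed one.\<close>

lemma quasi_gibbs_measure_cylinder:
  assumes \<mu>: "quasi_gibbs_measure q \<rho> h \<mu>" and n: "n \<ge> 1" and E: "E \<subseteq> configs_on q (tree_V n)"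
    and q: "q > 0"
  shows "\<mu> (cylinder q n E) = (\<Sum>\<tau>\<in>E. potts_mu q \<rho> h n \<tau>)"
proof -
  have add: "\<mu> (A \<union> B) = \<mu> A + \<mu> B" if "A \<in> cylinders q" "B \<in> cylinders q" "A \<inter> B = {}" for A B
    using \<mu> that unfolding quasi_gibbs_measure_def padic_prob_measure_def padic_measure_def by blast
  have "finite E" using E by (auto intro: finite_subset)
  thus ?thesis using E
  proof (induction E rule: finite_induct)
    case empty
    have "{} \<in> cylinders q" using cylinder_in_cylinders[of "{}" q 0] by (simp add: cylinder_def)
    hence "\<mu> {} = 0" using add[of "{}" "{}"] by simp
    thus ?case by (simp add: cylinder_def)
  next
    case (insert \<tau> E)
    have "\<mu> (cylinder q n {\<tau>} \<union> cylinder q n E) = \<mu> (cylinder q n {\<tau>}) + \<mu> (cylinder q n E)"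
      using insert.hyps insert.prems by (intro add cylinder_in_cylinders) (auto simp: cylinder_def)
    moreover have "\<mu> (cylinder q n {\<tau>}) = potts_mu q \<rho> h n \<tau>"
      using \<mu> n insert.prems unfolding quasi_gibbs_measure_def by blast
    ultimately show ?case
      using insert by (simp add: cylinder_Un)
  qed
qed

text \<open>By the ultrametric inequality a sum of densities is no larger than its largest term,
  however many configurations the base contains.\<close>

lemma padic_bounded_quasi_gibbs_measure:
  assumes \<mu>: "quasi_gibbs_measure q \<rho> h \<mu>" and q: "q > 0" and c: "c \<ge> 0"
    and bound: "\<And>n \<sigma>. n \<ge> 1 \<Longrightarrow> \<sigma> \<in> configs_on q (tree_V n) \<Longrightarrow> padic_norm (potts_mu q \<rho> h n \<sigma>) \<le> c"
  shows "padic_bounded (cylinders q) \<mu>"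
  unfolding padic_bounded_def
proof (rule bdd_aboveI2[where M = c])
  fix A assume "A \<in> cylinders q"
  then obtain n E where n: "n \<ge> 1" and E: "E \<subseteq> configs_on q (tree_V n)" and A: "A = cylinder q n E"
    by (rule cylinders_level)
  show "padic_norm (\<mu> A) \<le> c"
    unfolding A quasi_gibbs_measure_cylinder[OF \<mu> n E q] using E n c bound
    by (intro padic_norm_sum_le) auto
qed

section \<open>Norm bounds on the invariant line and comparison of the two measures\<close>

lemma padic_norm_potts_Z_invariant_line:
  assumes fp: "fixed_point_equation q \<rho> k" and i0: "i\<^sub>0 < q"
    and unit: "padic_norm (k + \<rho> + of_nat q - 2) = 1"
  shows "padic_norm (potts_Z q \<rho> (invariant_line i\<^sub>0 k) n) = padic_norm (k + of_nat q - 1)"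
proof (induction n)
  case 0
  thus ?case using i0 by (simp add: potts_Z_0_invariant_line)
next
  case (Suc n)
  thus ?case
    by (simp add: potts_Z_Suc_invariant_line[OF fp i0] padic_norm_mult padic_norm_power unit)
qed

lemma padic_norm_potts_weight_invariant_line:
  assumes "padic_norm \<rho> \<le> 1" "padic_norm k \<le> 1"
  shows "padic_norm (potts_weight \<rho> (invariant_line i\<^sub>0 k) n \<sigma>) \<le> 1"
  unfolding potts_weight_def using assms
  by (intro padic_norm_mult_le_1 padic_norm_prod_le_1)
    (auto simp: invariant_line_def padic_norm_power power_le_one)

lemma padic_norm_potts_mu_invariant_line:
  assumes "fixed_point_equation q \<rho> k" "i\<^sub>0 < q" "padic_norm (k + \<rho> + of_nat q - 2) = 1"
    "padic_norm \<rho> \<le> 1" "padic_norm k \<le> 1"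
  shows "padic_norm (potts_mu q \<rho> (invariant_line i\<^sub>0 k) n \<sigma>) \<le> 1 / padic_norm (k + of_nat q - 1)"
  using padic_norm_potts_weight_invariant_line[of \<rho> k i\<^sub>0 n \<sigma>]
    padic_norm_potts_Z_invariant_line[of q \<rho> k i\<^sub>0 n] assms
  by (simp add: potts_mu_def padic_norm_mult padic_norm_divide divide_right_mono)

lemma padic_bounded_invariant_line:
  assumes "quasi_gibbs_measure q \<rho> (invariant_line i\<^sub>0 k) \<mu>"
    "fixed_point_equation q \<rho> k" "i\<^sub>0 < q" "padic_norm (k + \<rho> + of_nat q - 2) = 1"
    "padic_norm \<rho> \<le> 1" "padic_norm k \<le> 1"
  shows "padic_bounded (cylinders q) \<mu>"
proof (rule padic_bounded_quasi_gibbs_measure[OF assms(1)])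
  show "padic_norm (potts_mu q \<rho> (invariant_line i\<^sub>0 k) n \<sigma>) \<le> 1 / padic_norm (k + of_nat q - 1)" for n \<sigma>
    using assms by (intro padic_norm_potts_mu_invariant_line)
qed (use assms in auto)

lemma translation_invariant_invariant_line: "translation_invariant q (invariant_line i\<^sub>0 k)"
  by (simp add: translation_invariant_def invariant_line_def)

text \<open>A configuration with no two equal neighbours has energy 0 and, for boundary value 1,
  weight 1. Its density serves to tell the two measures apart.\<close>

lemma potts_mu_1_invariant_line_1:
  fixes \<rho> :: "'p::prime_card padic"
  assumes "q \<ge> 2"
  obtains \<sigma> where "\<sigma> \<in> configs_on q (tree_V 1)"
    "potts_mu q \<rho> (invariant_line i\<^sub>0 1) 1 \<sigma> = 1 / potts_Z q \<rho> (invariant_line i\<^sub>0 1) 1"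
proof -
  define \<sigma> :: "vertex \<Rightarrow> nat" where "\<sigma> = restrict (\<lambda>x. if x = root then 0 else 1) (tree_V 1)"
  have "\<sigma> \<in> configs_on q (tree_V 1)" using assms by (auto simp: \<sigma>_def configs_on_def)
  moreover have "hamiltonian 1 \<sigma> = 0"
    unfolding hamiltonian_def
    by (rule sum.neutral) (auto simp: \<sigma>_def tree_L_def tree_V_def tree_W_def)
  hence "potts_weight \<rho> (invariant_line i\<^sub>0 1) 1 \<sigma> = 1"
    by (simp add: potts_weight_def invariant_line_def)
  ultimately show thesis by (intro that[of \<sigma>]) (auto simp: potts_mu_def)
qed

theorem theorem5p3:
  fixes p q i\<^sub>0 :: nat
    and \<rho> :: "'p::prime_card padic"
    and a\<^sub>0 b\<^sub>0 D\<^sub>0 :: int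
    and u :: "nat \<Rightarrow> int"
  assumes p_card: "p = CARD('p)" and "p > 3"
    and "q \<ge> 3"
    and "i\<^sub>0 \<in> {1..q - 1}"
    and "padic_norm \<rho> \<le> 1 / real p ^ 2"
    and "padic_norm (of_nat q :: 'p padic) \<le> 1 / real p ^ 2"
    and "p = 11 \<or> p = 19 \<or>
      (p \<noteq> 11 \<and> p \<noteq> 19 \<and>
       a\<^sub>0 \<in> {1..int p - 1} \<and> [3 * a\<^sub>0 = - 4] (mod int p) \<and>
       b\<^sub>0 \<in> {1..int p - 1} \<and> [27 * b\<^sub>0 = - 38] (mod int p) \<and>
       D\<^sub>0 = - 4 * a\<^sub>0 ^ 3 - 27 * b\<^sub>0 ^ 2 \<and>
       u 1 = 0 \<and> u 2 = - a\<^sub>0 \<and> u 3 = b\<^sub>0 \<and>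
       (\<forall>n\<ge>1. u (n + 3) = b\<^sub>0 * u n - a\<^sub>0 * u (n + 1)) \<and>
       \<not> [D\<^sub>0 * u (p - 2) ^ 2 = 0] (mod int p) \<and>
       \<not> [D\<^sub>0 * u (p - 2) ^ 2 = 9 * a\<^sub>0 ^ 2] (mod int p))"
  shows
    "(\<exists>x \<mu>\<^sub>0 \<mu>.
        cubic q \<rho> x = 0 \<and>
        corresponds_to q \<rho> i\<^sub>0 \<mu>\<^sub>0 1 \<and> translation_invariant_quasi_gibbs q \<rho> \<mu>\<^sub>0 \<and>
        corresponds_to q \<rho> i\<^sub>0 \<mu> x \<and> translation_invariant_quasi_gibbs q \<rho> \<mu> \<and>
        (\<exists>A\<in>cylinders q. \<mu>\<^sub>0 A \<noteq> \<mu> A)) \<and>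
     (\<forall>x \<mu>\<^sub>0 \<mu>.
        cubic q \<rho> x = 0 \<and> corresponds_to q \<rho> i\<^sub>0 \<mu>\<^sub>0 1 \<and> corresponds_to q \<rho> i\<^sub>0 \<mu> x \<longrightarrow>
        padic_bounded (cylinders q) \<mu>\<^sub>0 \<and> padic_bounded (cylinders q) \<mu>) \<and>
     quasi_phase_transition q \<rho>"
proof -
  have p: "CARD('p) > 3" using assms by simp
  have "1 / real p ^ 2 < 1" using \<open>p > 3\<close> by (simp add: one_less_power)
  hence \<rho>: "padic_norm \<rho> < 1" and qn: "padic_norm (of_nat q :: 'p padic) < 1"
    using assms by linarith+
  have i0: "i\<^sub>0 < q" "i\<^sub>0 \<noteq> 0" and q: "q > 0" "q \<ge> 2" using assms by auto
  have norm1: "padic_norm (1 + \<rho> + of_nat q - 2) = 1"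
    using padic_norm_add_eq_left[of "\<rho> + of_nat q" "- 1"] padic_norm_add_less[OF \<rho> qn]
    by (simp add: algebra_simps)
  hence fp1: "fixed_point_equation q \<rho> 1" by (intro fixed_point_equation_1) auto
  note norms = cubic_root_norms[OF p \<rho> qn]
  obtain n where "int CARD('p) dvd n ^ 3 - 5 * n ^ 2 + 7 * n - 1" "\<not> int CARD('p) dvd 3 * n ^ 2 - 10 * n + 7"
    using fixed_point_cubic_root_mod_p[where 'p = 'p, of a\<^sub>0 b\<^sub>0 D\<^sub>0 u] assms(2,7) unfolding p_card by blast
  then obtain x where x: "cubic q \<rho> x = 0" using cubic_has_padic_root[OF \<rho> qn] by blast
  have fpx: "fixed_point_equation q \<rho> x"
    using norms(2)[OF x] by (intro fixed_point_equation_cubic[OF x]) auto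
  define h where "h = (\<lambda>k :: 'p padic. invariant_line i\<^sub>0 k)"
  define \<mu>\<^sub>0 \<mu> where "\<mu>\<^sub>0 = cylinder_measure q \<rho> (h 1)" and "\<mu> = cylinder_measure q \<rho> (h x)"
  have gibbs: "quasi_gibbs_measure q \<rho> (h k) (cylinder_measure q \<rho> (h k))"
    if "fixed_point_equation q \<rho> k" "k + of_nat q - 1 \<noteq> 0" for k
    unfolding h_def using that i0 q
    by (intro quasi_gibbs_measure_cylinder_measure compatible_invariant_line)
      (auto simp: invariant_line_def)
  \<comment> \<open>For the boundary value 1 the factor at the root is \<open>of_nat q\<close>,
    which is nonzero in characteristic 0.\<close>
  have g0: "quasi_gibbs_measure q \<rho> (h 1) \<mu>\<^sub>0"
    unfolding \<mu>\<^sub>0_def using q by (intro gibbs fp1) simp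
  have gx: "quasi_gibbs_measure q \<rho> (h x) \<mu>"
    unfolding \<mu>_def using norms(3)[OF x] by (intro gibbs fpx) auto
  have bounded: "padic_bounded (cylinders q) \<nu>"
    if "corresponds_to q \<rho> i\<^sub>0 \<nu> k" "k = 1 \<or> cubic q \<rho> k = 0" for \<nu> k
    using that norm1 norms(1,2)[of k] \<rho> i0
    by (intro padic_bounded_invariant_line[of q \<rho> i\<^sub>0 k]) (auto simp: corresponds_to_def)
  have c0: "corresponds_to q \<rho> i\<^sub>0 \<mu>\<^sub>0 1" and cx: "corresponds_to q \<rho> i\<^sub>0 \<mu> x"
    using fp1 fpx g0 gx by (simp_all add: corresponds_to_def h_def)
  have ti: "translation_invariant_quasi_gibbs q \<rho> \<mu>\<^sub>0" "translation_invariant_quasi_gibbs q \<rho> \<mu>"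
    using g0 gx translation_invariant_invariant_line
    unfolding translation_invariant_quasi_gibbs_def h_def by blast+
  \<comment> \<open>On the cylinder of \<open>\<sigma>\<close> the first measure has norm
    \<open>1 / padic_norm (of_nat q)\<close>, which exceeds 1, while the densities of the second
    have norm at most 1.\<close>
  have "\<exists>A\<in>cylinders q. \<mu>\<^sub>0 A \<noteq> \<mu> A"
  proof -
    obtain \<sigma> where \<sigma>: "\<sigma> \<in> configs_on q (tree_V 1)"
      and mu: "potts_mu q \<rho> (h 1) 1 \<sigma> = 1 / potts_Z q \<rho> (h 1) 1"
      using potts_mu_1_invariant_line_1[OF q(2)] unfolding h_def by blast
    have val: "\<mu>\<^sub>0 (cylinder q 1 {\<sigma>}) = potts_mu q \<rho> (h 1) 1 \<sigma>" "\<mu> (cylinder q 1 {\<sigma>}) = potts_mu q \<rho> (h x) 1 \<sigma>"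
      using g0 gx \<sigma> unfolding quasi_gibbs_measure_def by auto
    have "padic_norm (\<mu> (cylinder q 1 {\<sigma>})) \<le> 1"
      using padic_norm_potts_mu_invariant_line[OF fpx i0(1), of 1 \<sigma>] norms[OF x] \<rho> val
      by (simp add: h_def)
    moreover have "padic_norm (potts_Z q \<rho> (h 1) 1) = padic_norm (of_nat q :: 'p padic)"
      using padic_norm_potts_Z_invariant_line[OF fp1 i0(1) norm1, of 1] by (simp add: h_def)
    hence "padic_norm (\<mu>\<^sub>0 (cylinder q 1 {\<sigma>})) = 1 / padic_norm (of_nat q :: 'p padic)"
      unfolding val mu by (simp add: padic_norm_divide)
    moreover have "padic_norm (of_nat q :: 'p padic) > 0"
      using padic_norm_nonneg[of "of_nat q :: 'p padic"] padic_norm_eq_0_iff[of "of_nat q :: 'p padic"] q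
      by (simp add: less_le)
    ultimately have "\<mu>\<^sub>0 (cylinder q 1 {\<sigma>}) \<noteq> \<mu> (cylinder q 1 {\<sigma>})"
      using qn by (auto simp: field_simps)
    thus ?thesis using cylinder_in_cylinders[of "{\<sigma>}" q 1] \<sigma> by blast
  qed
  moreover have "quasi_phase_transition q \<rho>"
  proof -
    \<comment> \<open>At \<open>x = 1\<close> the unit \<open>x + of_nat q - 1\<close> would be
      \<open>of_nat q\<close>, whose norm is below 1.\<close>
    have "x \<noteq> 1" using norms(3)[OF x] qn by auto
    hence "[0 :: 3] \<noteq> root \<and> i\<^sub>0 < q \<and> h 1 [0] i\<^sub>0 \<noteq> h x [0] i\<^sub>0"
      using i0 by (simp add: h_def invariant_line_def)
    thus ?thesis
      using g0 gx bounded[OF c0] bounded[OF cx] x unfolding quasi_phase_transition_def by blast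
  qed
  ultimately show ?thesis using x c0 cx ti bounded by blast
qed

end
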